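(* Let $h:\mathbb{R}\to\mathbb{R}$ and let $(\mu_t)_{t\in[0,1]}$ be a family of Borel probability measures on $\mathbb{R}$ such that assumptions (1)–(6) listed in the context hold. Then the process $X^{opt}_t$ (defined in the context) is the unique maximizer of $$E\Big(h\Big(\int_0^1 X_t\,dt\Big)\Big)$$ among all processes $X=(X_t)_{t\in[0,1]}$ in $\Pi$.
   Context: $\Pi$ is the set of all real-valued measurable stochastic processes $(X_t)_{t\in[0,1]}$ (on any probability space) with continuous sample paths such that $\mathrm{law}(X_t)=\mu_t$ for all $t\in[0,1]$. Processes are identified with the probability measures they induce on the space of continuous functions on $[0,1]$, and uniqueness is understood in this sense. $F_t$ denotes the cumulative distribution function of $\mu_t$, and for $\lambda\in(0,1)$, $x_\lambda(t)=F_t^{-1}(\lambda)$. Assumptions: (1) $h$ is strictly convex and $C^2$. (2) Each $\mu_t$ is absolutely continuous with respect to Lebesgue measure. (3) The support of each $\mu_t$ is a (possibly unbounded) interval $\mathrm{spt}\,\mu_t=[a_t,b_t]$, where $a_t$ may be $-\infty$ and $b_t$ may be $+\infty$. (4) The path $t\mapsto\mu_t$ is weakly continuous. (5) The first moments and $h$-moments of $\mu_t$ exist and are integrable in $t$: $\int_0^1\big|\int_{\mathbb{R}}x\,d\mu_t(x)\big|dt<\infty$ and $\int_0^1\big|\int_{\mathbb{R}}h(x)\,d\mu_t(x)\big|dt<\infty$. (6) The Riemann sums $\frac1N\sum_{i=1}^N x_\lambda(\frac iN)$ converge to $\int_0^1 x_\lambda(t)\,dt$ as $N\to\infty$, uniformly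 in $\lambda$ on compact subsets of $(0,1)$. The process $X^{opt}$: the underlying probability space is $(0,1)$ with Lebesgue measure, and $X^{opt}_t(\lambda)=x_\lambda(t)$. *)

theory Defs
  imports "HOL-Probability.Probability"
begin

definition strictly_convex :: "(real \<Rightarrow> real) \<Rightarrow> bool" where
  "strictly_convex h \<longleftrightarrow>
     (\<forall>x y u. x \<noteq> y \<and> 0 < u \<and> u < 1 \<longrightarrow> h (u * x + (1 - u) * y) < u * h x + (1 - u) * h y)"

definition C2_function :: "(real \<Rightarrow> real) \<Rightarrow> bool" where
  "C2_function h \<longleftrightarrow>
     (\<exists>D. (\<forall>x. (h has_real_derivative D x) (at x)) \<and> D C1_differentiable_on UNIV)"

definition measure_support :: "real measure \<Rightarrow> real set" where
  "measure_support M = {x. \<forall>U. open U \<and> x \<in> U \<longrightarrow> 0 < emeasure M U}"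

definition weakly_continuous_path :: "(real \<Rightarrow> real measure) \<Rightarrow> bool" where
  "weakly_continuous_path \<mu> \<longleftrightarrow>
     (\<forall>f::real \<Rightarrow> real. continuous_on UNIV f \<and> bounded (range f) \<longrightarrow>
        continuous_on {0..1} (\<lambda>t. \<integral>x. f x \<partial>\<mu> t))"

text \<open>
  The inverse of the distribution function. It is used only for
  \<open>0 < q < 1\<close> and for atomless measures whose support is an interval; there the
  equation \<open>cdf M x = q\<close> has exactly one solution.
\<close>
definition cdf_inverse :: "real measure \<Rightarrow> real \<Rightarrow> real" where
  "cdf_inverse M q = (THE x. cdf M x = q)"

text \<open>
  A process consists of a probability space \<open>M\<close> and a family \<open>X\<close>; only the times
  in \<open>{0..1}\<close> matter. Measurability is joint measurability in time and outcome.
\<close>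
definition continuous_process :: "'w measure \<Rightarrow> (real \<Rightarrow> 'w \<Rightarrow> real) \<Rightarrow> bool" where
  "continuous_process M X \<longleftrightarrow>
     prob_space M \<and>
     (\<lambda>(t, \<omega>). X t \<omega>) \<in> borel_measurable (restrict_space borel {0..1} \<Otimes>\<^sub>M M) \<and>
     (\<forall>\<omega>\<in>space M. continuous_on {0..1} (\<lambda>t. X t \<omega>))"

definition processes_with_marginals ::
    "(real \<Rightarrow> real measure) \<Rightarrow> ('w measure \<times> (real \<Rightarrow> 'w \<Rightarrow> real)) set" where
  "processes_with_marginals \<mu> =
     {(M, X). continuous_process M X \<and> (\<forall>t\<in>{0..1}. distr M borel (X t) = \<mu> t)}"

text \<open>
  The space of continuous functions on \<open>{0..1}\<close> with the uniform metric, equipped with its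
  Borel sigma-algebra. Its points are extensional, hence the restriction in \<open>path_law\<close>.
\<close>
definition path_space :: "(real \<Rightarrow> real) measure" where
  "path_space =
     (let C = cfunspace (top_of_set {0..1}) euclidean_metric
      in sigma (mspace C) {U. openin (mtopology_of C) U})"

definition path_law :: "'w measure \<Rightarrow> (real \<Rightarrow> 'w \<Rightarrow> real) \<Rightarrow> (real \<Rightarrow> real) measure" where
  "path_law M X = distr M path_space (\<lambda>\<omega>. \<lambda>t\<in>{0..1}. X t \<omega>)"

definition payoff :: "(real \<Rightarrow> real) \<Rightarrow> (real \<Rightarrow> 'w \<Rightarrow> real) \<Rightarrow> 'w \<Rightarrow> real" where
  "payoff h X \<omega> = h (LINT t:{0..1}|lborel. X t \<omega>)"

definition opt_space :: "real measure" where
  "opt_space = restrict_space lborel {0<..<1}"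

definition opt_process :: "(real \<Rightarrow> real measure) \<Rightarrow> real \<Rightarrow> real \<Rightarrow> real" where
  "opt_process \<mu> t q = cdf_inverse (\<mu> t) q"

end

theory Submission
  imports Defs
begin

text \<open>
  Write \<open>Y = \<integral> X t dt\<close> and \<open>Z q = \<integral> x\<^sub>q(t) dt\<close>. At a strike \<open>k = Z q\<close>,
  \<open>E (Y - k)\<^sup>+ \<le> \<integral> E (X t - x\<^sub>q(t))\<^sup>+ dt\<close>, and the right-hand side depends only on the marginals. For the
  quantile process there is equality, because its paths do not cross. Hence \<open>Y\<close> is dominated by \<open>Z\<close>
  in convex order, and writing \<open>h\<close> as an affine function plus the mixture of calls and puts with
  density \<open>h''\<close> gives the inequality of payoffs. Strict convexity makes \<open>h''\<close> positive on a dense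
  open set, so equality of payoffs forces equality at every strike. Then almost surely no path crosses
  the quantile path of any rational level, so \<open>X\<close> runs along a single quantile path, whose level is
  uniformly distributed.
\<close>

section \<open>Quantile functions of atomless distributions on an interval\<close>

text \<open>The call inequality is available only at strikes \<open>Z q\<close>, and
  \<open>q\<close> runs through the open unit interval, so a strike outside the range of
  \<open>Z\<close> has to be approached by letting \<open>q\<close> tend to 0 or 1. Below the range
  calls do not become small; there one passes to puts, which is legitimate because both averages
  have the same mean. The mixture is kept free of convergence problems by subtracting the tangent of
  \<open>h\<close> at 0: the affine part has the same expectation for every process, and the
  nonnegative remainder \<open>G\<close> is integrated in \<open>ennreal\<close>. Its finiteness,
  without which equality of payoffs would say nothing, comes from Jensen's inequality. The
  assumptions integrate only signed means over time; the absolute first moment that Fubini requires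
  is recovered from the at least linear growth of \<open>G\<close>. Equality of the mixtures gives
  equal call prices only at almost every strike with positive \<open>D2\<close>; Lipschitz
  dependence on the strike carries this to all strikes.\<close>

locale interval_distribution = real_distribution M for M +
  assumes absolutely_continuous_lborel: "absolutely_continuous lborel M"
    and support_interval:
      "\<exists>a b :: ereal. measure_support M = {x. a \<le> ereal x \<and> ereal x \<le> b}"
begin

lemma isCont_cdf_point: "isCont (cdf M) x"
  using absolutely_continuous_lborel
  by (auto simp: isCont_cdf absolutely_continuous_def null_sets_def measure_def subset_iff)

text \<open>The complement of the support is a union of open null sets. By Lindelof countably many
  of them cover it, so it is null.\<close>

lemma positive_measure_meets_support:
  assumes A: "A \<in> sets borel" and pos: "0 < measure M A"
  shows "\<exists>x\<in>A. x \<in> measure_support M"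
proof (rule ccontr)
  assume no: "\<not> ?thesis"
  define F where "F = {U :: real set. open U \<and> emeasure M U = 0}"
  obtain F' where F': "F' \<subseteq> F" "countable F'" "\<Union>F' = \<Union>F"
    using Lindelof[of F] unfolding F_def by blast
  have "A \<subseteq> \<Union>F"
    using no by (force simp: F_def measure_support_def)
  moreover have "\<Union>F' \<in> null_sets M"
    using F' by (intro null_sets_UN'[of F' "\<lambda>x. x", simplified]) (auto simp: F_def null_sets_def)
  ultimately have "A \<in> null_sets M"
    using A F'(3) null_sets_subset[of "\<Union>F'" M A] by auto
  then show False
    using pos by (auto simp: null_sets_def measure_def)
qed

text \<open>Existence is the intermediate value theorem, as there are no atoms. Two solutions would
  enclose an open interval of mass 0, while masses \<open>q\<close> and \<open>1 - q\<close> on its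
  two sides provide support points there; the support, being an interval, would then contain the
  midpoint.\<close>

lemma ex1_cdf_eq:
  assumes q: "0 < q" "q < 1"
  shows "\<exists>!x. cdf M x = q"
proof -
  have "eventually (\<lambda>x. cdf M x < q) at_bot"
    using order_tendstoD(2)[OF cdf_lim_at_bot q(1)] .
  then obtain a where a: "cdf M a < q"
    by (auto simp: eventually_at_bot_linorder)
  have "eventually (\<lambda>x. q < cdf M x) at_top"
    using order_tendstoD(1)[OF cdf_lim_at_top_prob q(2)] .
  then obtain b where b: "q < cdf M b"
    by (auto simp: eventually_at_top_linorder)
  have "a \<le> b"
    using a b cdf_nondecreasing[of b a] by (meson linorder_le_cases not_less order_trans less_imp_le)
  then obtain x where x: "cdf M x = q"
    using IVT[of "cdf M" a q b] a b isCont_cdf_point by auto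
  have False if xy: "x < y" "cdf M x = q" "cdf M y = q" for x y
  proof -
    obtain u where u: "u \<le> x" "u \<in> measure_support M"
      using positive_measure_meets_support[of "{..x}"] xy q(1) by (auto simp: cdf_def)
    have "measure M {y<..} = 1 - q"
      using prob_compl[of "{..y}"] that by (simp add: cdf_def Compl_atMost flip: Compl_eq_Diff_UNIV)
    then obtain v where v: "y < v" "v \<in> measure_support M"
      using positive_measure_meets_support[of "{y<..}"] q by auto
    have "(x + y) / 2 \<in> measure_support M"
    proof -
      obtain \<alpha> \<beta> where S: "measure_support M = {x. \<alpha> \<le> ereal x \<and> ereal x \<le> \<beta>}"
        using support_interval by blast
      have "ereal u \<le> ereal ((x + y) / 2)" "ereal ((x + y) / 2) \<le> ereal v"
        using that u v by auto
      then show ?thesis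
        using u(2) v(2) order_trans[of \<alpha> "ereal u"] order_trans[of _ "ereal v" \<beta>]
        unfolding S by blast
    qed
    then have "0 < emeasure M {x<..<y}"
      using that(1) unfolding measure_support_def
      by (auto dest!: spec[of _ "{x<..<y}"])
    also have "\<dots> \<le> emeasure M {x<..y}"
      by (intro emeasure_mono) auto
    finally show False
      using emeasure_Ioc[of x y] that by simp
  qed
  then show ?thesis
    using x by (metis linorder_neqE)
qed

lemma cdf_cdf_inverse:
  assumes "0 < q" "q < 1"
  shows "cdf M (cdf_inverse M q) = q"
  unfolding cdf_inverse_def using theI'[OF ex1_cdf_eq[OF assms]] .

lemma cdf_inverse_cdf:
  assumes "0 < cdf M x" "cdf M x < 1"
  shows "cdf_inverse M (cdf M x) = x"
  using ex1_cdf_eq[OF assms] cdf_cdf_inverse[OF assms] by blast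

text \<open>Since level \<open>q\<close> is attained exactly once, strict comparison with the
  quantile is an equivalence on both sides. Continuity of the quantiles is read off from this
  pair.\<close>

lemma cdf_inverse_less_iff:
  assumes q: "0 < q" "q < 1"
  shows "cdf_inverse M q < y \<longleftrightarrow> q < cdf M y"
  using cdf_cdf_inverse[OF q] ex1_cdf_eq[OF q] cdf_nondecreasing
  by (metis less_le not_le)

lemma less_cdf_inverse_iff:
  assumes q: "0 < q" "q < 1"
  shows "y < cdf_inverse M q \<longleftrightarrow> cdf M y < q"
  using cdf_cdf_inverse[OF q] ex1_cdf_eq[OF q] cdf_nondecreasing
  by (metis less_le not_le)

lemma cdf_inverse_mono:
  assumes "0 < p" "p \<le> q" "q < 1"
  shows "cdf_inverse M p \<le> cdf_inverse M q"
  using assms cdf_inverse_less_iff[of q "cdf_inverse M p"] cdf_cdf_inverse[of p] by auto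

end

lemma prob_space_restrict_lborel_unit:
  "prob_space (restrict_space lborel {0<..<1::real})"
  "prob_space (restrict_space lborel {0..1::real})"
  by (auto intro!: prob_spaceI simp: emeasure_restrict_space space_restrict_space)

section \<open>Quantiles along a weakly continuous path of measures\<close>

locale quantile_path =
  fixes \<mu> :: "real \<Rightarrow> real measure"
  assumes interval_distribution: "t \<in> {0..1} \<Longrightarrow> interval_distribution (\<mu> t)"
    and weakly_continuous: "weakly_continuous_path \<mu>"
begin

text \<open>The ramps \<open>cts_step u v\<close> are bounded continuous test functions, and testing
  them gives weak convergence. This controls the cdf only at continuity points of the limit; without
  atoms every \<open>y\<close> is one.\<close>

lemma continuous_on_cdf: "continuous_on {0..1} (\<lambda>t. cdf (\<mu> t) y)"
  unfolding continuous_on_sequentially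
proof (intro allI ballI impI)
  fix x :: "nat \<Rightarrow> real" and a
  assume a: "a \<in> {0..1}" and x: "(\<forall>n. x n \<in> {0..1}) \<and> x \<longlonglongrightarrow> a"
  have *: "real_distribution (\<mu> t)" if "t \<in> {0..1}" for t
    using interval_distribution[OF that] by (simp add: interval_distribution_def)
  have "weak_conv_m (\<lambda>n. \<mu> (x n)) (\<mu> a)"
  proof (rule integral_cts_step_conv_imp_weak_conv)
    fix u v :: real assume "u < v"
    have "continuous_on UNIV (cts_step u v)"
      using cts_step_uniformly_continuous[OF \<open>u < v\<close>]
      by (rule uniformly_continuous_imp_continuous)
    moreover have "bounded (range (cts_step u v))"
      using \<open>u < v\<close> by (intro boundedI[of _ 1]) (auto simp: cts_step_def)
    ultimately have "continuous_on {0..1} (\<lambda>t. \<integral>z. cts_step u v z \<partial>\<mu> t)"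
      using weakly_continuous unfolding weakly_continuous_path_def by blast
    then show "(\<lambda>n. integral\<^sup>L (\<mu> (x n)) (cts_step u v)) \<longlonglongrightarrow> integral\<^sup>L (\<mu> a) (cts_step u v)"
      using a x unfolding continuous_on_sequentially by (auto simp: o_def)
  qed (use * a x in auto)
  then show "((\<lambda>t. cdf (\<mu> t) y) \<circ> x) \<longlonglongrightarrow> cdf (\<mu> a) y"
    using interval_distribution.isCont_cdf_point[OF interval_distribution[OF a]]
    by (auto simp: weak_conv_m_def weak_conv_def o_def)
qed

text \<open>A comparison of the quantile with a fixed \<open>y\<close> is a condition on the sign of
  \<open>q - cdf (\<mu> t) y\<close>, which is jointly continuous in time and level; so both order
  conditions for the limit are open.\<close>

lemma continuous_on_quantile:
  "continuous_on ({0..1} \<times> {0<..<1}) (\<lambda>(t, q). cdf_inverse (\<mu> t) q)"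
  unfolding continuous_on_def
proof (intro ballI, clarify)
  fix t q :: real assume tq: "t \<in> {0..1}" "q \<in> {0<..<1}"
  let ?F = "at (t, q) within {0..1} \<times> {0<..<1}"
  have in_S: "eventually (\<lambda>p. p \<in> {0..1} \<times> {0<..<1}) ?F"
    by (simp add: eventually_at_filter)
  have "continuous_on ({0..1} \<times> {0<..<1}) (\<lambda>p. snd p - cdf (\<mu> (fst p)) y)" for y :: real
    by (intro continuous_intros continuous_on_compose2[OF continuous_on_cdf]) auto
  then have lim: "((\<lambda>p. snd p - cdf (\<mu> (fst p)) y) \<longlongrightarrow> q - cdf (\<mu> t) y) ?F" for y
    using tq unfolding continuous_on_def by force
  show "((\<lambda>(t, q). cdf_inverse (\<mu> t) q) \<longlongrightarrow> cdf_inverse (\<mu> t) q) ?F"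
  proof (rule order_tendstoI)
    fix y assume "y < cdf_inverse (\<mu> t) q"
    then have "0 < q - cdf (\<mu> t) y"
      using interval_distribution.less_cdf_inverse_iff[OF interval_distribution] tq by auto
    from in_S order_tendstoD(1)[OF lim this]
    show "eventually (\<lambda>p. y < (case p of (t, q) \<Rightarrow> cdf_inverse (\<mu> t) q)) ?F"
      by eventually_elim
         (auto simp: interval_distribution.less_cdf_inverse_iff[OF interval_distribution])
  next
    fix y assume "cdf_inverse (\<mu> t) q < y"
    then have "q - cdf (\<mu> t) y < 0"
      using interval_distribution.cdf_inverse_less_iff[OF interval_distribution] tq by auto
    from in_S order_tendstoD(2)[OF lim this]
    show "eventually (\<lambda>p. (case p of (t, q) \<Rightarrow> cdf_inverse (\<mu> t) q) < y) ?F"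
      by eventually_elim
         (auto simp: interval_distribution.cdf_inverse_less_iff[OF interval_distribution])
  qed
qed

lemma opt_process_measurable:
  "(\<lambda>(t, q). opt_process \<mu> t q) \<in> borel_measurable (restrict_space borel {0..1} \<Otimes>\<^sub>M opt_space)"
    (is "_ \<in> borel_measurable ?P")
proof -
  have "(\<lambda>x. x) \<in> borel_measurable (restrict_space borel {0..1 :: real})"
    "(\<lambda>x. x) \<in> borel_measurable opt_space"
    unfolding opt_space_def by (auto intro!: measurable_restrict_space1)
  then have "fst \<in> borel_measurable ?P" "snd \<in> borel_measurable ?P"
    by (auto intro: measurable_compose[OF measurable_fst] measurable_compose[OF measurable_snd])
  then have "(\<lambda>p. (fst p, snd p)) \<in> measurable ?P (borel \<Otimes>\<^sub>M borel)"
    by (rule measurable_Pair)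
  then have "(\<lambda>p. p) \<in> measurable ?P (restrict_space borel ({0..1} \<times> {0<..<1}))"
    by (intro measurable_restrict_space2)
       (auto simp: borel_prod space_pair_measure space_restrict_space opt_space_def)
  from measurable_compose[OF this borel_measurable_continuous_on_restrict[OF continuous_on_quantile]]
  show ?thesis
    by (simp add: opt_process_def)
qed

lemma distr_opt_process:
  assumes t: "t \<in> {0..1}"
  shows "distr opt_space borel (opt_process \<mu> t) = \<mu> t"
proof -
  interpret interval_distribution "\<mu> t" by (rule interval_distribution[OF t])
  interpret O: prob_space opt_space
    unfolding opt_space_def by (rule prob_space_restrict_lborel_unit)
  have meas: "opt_process \<mu> t \<in> borel_measurable opt_space"
    using measurable_compose[OF measurable_Pair1' opt_process_measurable, of t] t
    by (simp add: space_restrict_space)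
  show ?thesis
  proof (rule cdf_unique)
    show "real_distribution (distr opt_space borel (opt_process \<mu> t))"
      using meas by (rule O.real_distribution_distr)
    show "real_distribution (\<mu> t)" ..
    show "cdf (distr opt_space borel (opt_process \<mu> t)) = cdf (\<mu> t)"
    proof
      fix y
      have "cdf (distr opt_space borel (opt_process \<mu> t)) y
          = measure opt_space (opt_process \<mu> t -` {..y} \<inter> space opt_space)"
        using meas by (simp add: cdf_def measure_distr)
      also have "opt_process \<mu> t -` {..y} \<inter> space opt_space = {0<..<1} \<inter> {..cdf (\<mu> t) y}"
        using less_cdf_inverse_iff[of _ y]
        by (auto simp: opt_space_def space_restrict_space opt_process_def not_less[symmetric])
      also have "measure opt_space \<dots> = measure lborel ({0<..<1} \<inter> {..cdf (\<mu> t) y})"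
        unfolding opt_space_def by (intro measure_restrict_space) auto
      \<comment> \<open>Levels live in the open interval, so at cdf value 1 the right end point is
        missing.\<close>
      also have "{0<..<1} \<inter> {..cdf (\<mu> t) y} =
          (if cdf (\<mu> t) y = 1 then {0<..<1} else {0<..cdf (\<mu> t) y})"
        using cdf_bounded_prob[of y] by (auto simp: less_le)
      also have "measure lborel \<dots> = cdf (\<mu> t) y"
        using cdf_nonneg[of y] by auto
      finally show "cdf (distr opt_space borel (opt_process \<mu> t)) y = cdf (\<mu> t) y" .
    qed
  qed
qed

lemma continuous_on_opt_process:
  assumes "q \<in> {0<..<1}"
  shows "continuous_on {0..1} (\<lambda>t. opt_process \<mu> t q)"
  unfolding opt_process_def using assms
  by (intro continuous_on_compose2[OF continuous_on_quantile, of _ "\<lambda>t. (t, q)", simplified])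
     (auto intro!: continuous_intros)

lemma opt_process_in: "(opt_space, opt_process \<mu>) \<in> processes_with_marginals \<mu>"
  using opt_process_measurable distr_opt_process continuous_on_opt_process
    prob_space_restrict_lborel_unit(1)
  by (auto simp: processes_with_marginals_def continuous_process_def opt_space_def space_restrict_space)

end

section \<open>Measurability into the path space\<close>

text \<open>A list of rationals encodes the coefficients and, by its length minus one, the degree,
  so the approximants form a countable family. The values \<open>f (k / n)\<close> may be rounded by
  \<open>e / 2\<close> because the Bernstein polynomials are nonnegative and sum to 1.\<close>

lemma rational_Bernstein_dense:
  fixes f :: "real \<Rightarrow> real"
  assumes f: "continuous_on {0..1} f" and e: "0 < e"
  shows "\<exists>cs :: rat list. \<forall>x\<in>{0..1}.
           \<bar>f x - (\<Sum>k\<le>length cs - 1. of_rat (cs ! k) * Bernstein (length cs - 1) k x)\<bar> < e"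
proof -
  obtain n where n: "\<And>x. x \<in> {0..1} \<Longrightarrow> \<bar>f x - (\<Sum>k\<le>n. f (k / n) * Bernstein n k x)\<bar> < e / 2"
    using Bernstein_Weierstrass[OF f, of "e / 2"] e by auto
  have "\<exists>r. \<bar>f (k / n) - of_rat r\<bar> < e / 2" for k :: nat
  proof -
    obtain r where "f (k / n) - e / 2 < of_rat r" "of_rat r < f (k / n) + e / 2"
      using of_rat_dense[of "f (k / n) - e / 2" "f (k / n) + e / 2"] e by auto
    then show ?thesis
      by (intro exI[of _ r]) linarith
  qed
  then obtain r where r: "\<And>k :: nat. \<bar>f (k / n) - of_rat (r k)\<bar> < e / 2"
    by metis
  define cs where "cs = map r [0..<Suc n]"
  have len: "length cs - 1 = n"
    by (simp add: cs_def)
  have "\<bar>f x - (\<Sum>k\<le>n. of_rat (cs ! k) * Bernstein n k x)\<bar> < e" if x: "x \<in> {0..1}" for x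
  proof -
    have "\<bar>(\<Sum>k\<le>n. f (k / n) * Bernstein n k x) - (\<Sum>k\<le>n. of_rat (cs ! k) * Bernstein n k x)\<bar>
        = \<bar>\<Sum>k\<le>n. (f (k / n) - of_rat (r k)) * Bernstein n k x\<bar>"
      by (simp add: cs_def sum_subtractf left_diff_distrib nth_append del: upt_Suc)
    also have "\<dots> \<le> (\<Sum>k\<le>n. \<bar>f (k / n) - of_rat (r k)\<bar> * Bernstein n k x)"
      using x by (intro order_trans[OF sum_abs]) (auto simp: abs_mult Bernstein_nonneg)
    also have "\<dots> \<le> (\<Sum>k\<le>n. e / 2 * Bernstein n k x)"
      using x r by (intro sum_mono mult_right_mono) (auto simp: Bernstein_nonneg less_imp_le)
    also have "\<dots> = e / 2"
      unfolding sum_distrib_left[symmetric] sum_Bernstein by simp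
    finally show ?thesis
      using n[OF x] by linarith
  qed
  then show ?thesis
    using len by (intro exI[of _ cs]) simp
qed

lemma closure_unit_interval_Rats: "closure ({0<..<1} \<inter> \<rat>) = {0..1::real}"
proof -
  have "closure \<rat> = (UNIV :: real set)"
  proof (intro equalityI subsetI)
    fix x :: real
    show "x \<in> closure \<rat>"
      unfolding closure_approachable
    proof (intro allI impI)
      fix e :: real assume "0 < e"
      then obtain y where "y \<in> \<rat>" "x < y" "y < x + e"
        using Rats_dense_in_real[of x "x + e"] by auto
      then show "\<exists>y\<in>\<rat>. dist y x < e"
        by (intro bexI[of _ y]) (auto simp: dist_real_def)
    qed
  qed simp
  then show ?thesis
    using closure_open_Int_superset[of "{0<..<1::real}" \<rat>] by simp
qed

section \<open>Continuous paths under the uniform metric\<close>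

abbreviation "unit_cfun \<equiv> cfunspace (top_of_set {0..1::real}) (euclidean_metric :: real metric)"

declare mspace_cfunspace [simp del]

text \<open>Members of the function space are also required to be bounded; compactness of the unit
  interval makes this automatic.\<close>

lemma mspace_unit_cfun: "f \<in> mspace unit_cfun \<longleftrightarrow> f \<in> extensional {0..1} \<and> continuous_on {0..1} f"
  by (subst compactin_mspace_cfunspace) auto

lemma restrict_in_unit_cfun:
  assumes "continuous_on {0..1} f"
  shows "restrict f {0..1} \<in> mspace unit_cfun"
proof -
  have "continuous_on {0..1} (restrict f {0..1}) \<longleftrightarrow> continuous_on {0..1} f"
    by (intro continuous_on_cong) auto
  then show ?thesis
    using assms unfolding mspace_unit_cfun by auto
qed

lemma mdist_unit_cfun_le_iff:
  assumes "f \<in> mspace unit_cfun" "g \<in> mspace unit_cfun"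
  shows "mdist unit_cfun f g \<le> a \<longleftrightarrow> (\<forall>t\<in>{0..1}. \<bar>f t - g t\<bar> \<le> a)"
  using assms by (subst cfunspace_mdist_le) (auto simp: dist_real_def)

text \<open>The uniform norm of a continuous path is a supremum over rational times, and rational Bernstein
  polynomials are dense, so every open set is a countable union of closed balls whose preimages are
  measurable.\<close>

lemma measurable_path:
  assumes X: "\<And>t. t \<in> {0..1} \<Longrightarrow> X t \<in> borel_measurable M"
    and cont: "\<And>\<omega>. \<omega> \<in> space M \<Longrightarrow> continuous_on {0..1} (\<lambda>t. X t \<omega>)"
  shows "(\<lambda>\<omega>. \<lambda>t\<in>{0..1}. X t \<omega>) \<in> measurable M path_space"
  unfolding path_space_def Let_def
proof (rule measurable_measure_of)
  let ?P = "\<lambda>\<omega>. \<lambda>t\<in>{0..1}. X t \<omega>"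
  interpret C: Metric_space "mspace unit_cfun" "mdist unit_cfun"
    by (rule Metric_space_mspace_mdist)
  have P: "?P \<omega> \<in> mspace unit_cfun" if "\<omega> \<in> space M" for \<omega>
    using restrict_in_unit_cfun[OF cont[OF that]] .
  then show "?P \<in> space M \<rightarrow> mspace unit_cfun"
    by auto
  show "{U. openin (mtopology_of unit_cfun) U} \<subseteq> Pow (mspace unit_cfun)"
    by (auto dest!: openin_subset)
  fix U assume "U \<in> {U. openin (mtopology_of unit_cfun) U}"
  then have U: "openin C.mtopology U"
    by (simp add: mtopology_of_def)
  \<comment> \<open>The empty list gives a constant with an unspecified value. This is harmless:
    besides density, only continuity of each \<open>d cs\<close> is used.\<close>
  define d :: "rat list \<Rightarrow> real \<Rightarrow> real" where
    "d cs = (\<lambda>x\<in>{0..1}. \<Sum>k\<le>length cs - 1. of_rat (cs ! k) * Bernstein (length cs - 1) k x)" for cs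
  have d: "d cs \<in> mspace unit_cfun" for cs
    unfolding d_def Bernstein_def by (intro restrict_in_unit_cfun continuous_intros)
  define I where "I = {(cs, n). C.mcball (d cs) (1 / Suc n) \<subseteq> U}"
  have eq: "?P -` U \<inter> space M = (\<Union>(cs, n)\<in>I. {\<omega>\<in>space M. ?P \<omega> \<in> C.mcball (d cs) (1 / Suc n)})"
  proof (intro equalityI subsetI)
    fix \<omega> assume "\<omega> \<in> ?P -` U \<inter> space M"
    then have \<omega>: "\<omega> \<in> space M" "?P \<omega> \<in> U" by auto
    obtain r where r: "r > 0" "C.mball (?P \<omega>) r \<subseteq> U"
      using U \<omega>(2) unfolding C.openin_mtopology by blast
    \<comment> \<open>The centre \<open>d cs\<close> lies within \<open>1 / Suc n\<close> of the
      path, so its closed ball of that radius stays within twice this distance, which must be less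
      than \<open>r\<close>.\<close>
    obtain n where n: "1 / Suc n < r / 2"
      using nat_approx_posE[of "r / 2"] r by auto
    obtain cs where "\<forall>x\<in>{0..1}. \<bar>X x \<omega> - d cs x\<bar> < 1 / Suc n"
      using rational_Bernstein_dense[OF cont[OF \<omega>(1)], of "1 / Suc n"] by (auto simp: d_def)
    then have cs: "mdist unit_cfun (?P \<omega>) (d cs) \<le> 1 / Suc n"
      unfolding mdist_unit_cfun_le_iff[OF P[OF \<omega>(1)] d] by (auto simp: less_imp_le)
    have "C.mcball (d cs) (1 / Suc n) \<subseteq> C.mball (?P \<omega>) r"
      using cs n P[OF \<omega>(1)] d by (intro C.mcball_subset_mball) (auto simp: C.commute)
    then have "(cs, n) \<in> I"
      using r by (auto simp: I_def)
    moreover have "?P \<omega> \<in> C.mcball (d cs) (1 / Suc n)"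
      using cs P[OF \<omega>(1)] d by (simp add: C.commute)
    ultimately show "\<omega> \<in> (\<Union>(cs, n)\<in>I. {\<omega>\<in>space M. ?P \<omega> \<in> C.mcball (d cs) (1 / Suc n)})"
      using \<omega>(1) by blast
  qed (auto simp: I_def)
  have "{\<omega>\<in>space M. ?P \<omega> \<in> C.mcball (d cs) (1 / Suc n)} \<in> sets M" for cs n
  proof -
    let ?Q = "{0<..<1} \<inter> \<rat> :: real set"
    have "(\<forall>t\<in>{0..1}. \<bar>X t \<omega> - d cs t\<bar> \<le> 1 / Suc n) \<longleftrightarrow> (\<forall>t\<in>?Q. \<bar>X t \<omega> - d cs t\<bar> \<le> 1 / Suc n)"
      if \<omega>: "\<omega> \<in> space M" for \<omega>
    proof
      assume *: "\<forall>t\<in>?Q. \<bar>X t \<omega> - d cs t\<bar> \<le> 1 / Suc n"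
      have "continuous_on {0..1} (\<lambda>t. \<bar>X t \<omega> - d cs t\<bar>)"
        using cont[OF \<omega>] d[of cs, unfolded mspace_unit_cfun] by (intro continuous_intros) auto
      then show "\<forall>t\<in>{0..1}. \<bar>X t \<omega> - d cs t\<bar> \<le> 1 / Suc n"
        using continuous_le_on_closure[of ?Q "\<lambda>t. \<bar>X t \<omega> - d cs t\<bar>" _ "1 / Suc n"] *
        unfolding closure_unit_interval_Rats by blast
    qed auto
    moreover have "?P \<omega> \<in> C.mcball (d cs) (1 / Suc n) \<longleftrightarrow>
        (\<forall>t\<in>{0..1}. \<bar>X t \<omega> - d cs t\<bar> \<le> 1 / Suc n)" if \<omega>: "\<omega> \<in> space M" for \<omega>
      unfolding C.in_mcball mdist_unit_cfun_le_iff[OF d P[OF \<omega>]]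
      using P[OF \<omega>] d by (auto simp: abs_minus_commute)
    ultimately have "{\<omega>\<in>space M. ?P \<omega> \<in> C.mcball (d cs) (1 / Suc n)}
        = {\<omega>\<in>space M. \<forall>t\<in>?Q. \<bar>X t \<omega> - d cs t\<bar> \<le> 1 / Suc n}"
      by (intro Collect_cong conj_cong refl) metis
    also have "\<dots> \<in> sets M"
    proof (rule sets.sets_Collect_countable_All')
      show "countable ?Q" by (intro countable_Int2 countable_rat)
      show "{\<omega> \<in> space M. \<bar>X t \<omega> - d cs t\<bar> \<le> 1 / Suc n} \<in> sets M" if "t \<in> ?Q" for t
      proof -
        have [measurable]: "X t \<in> borel_measurable M"
          using that by (intro X) auto
        show ?thesis by measurable
      qed
    qed
    finally show ?thesis .
  qed
  then show "?P -` U \<inter> space M \<in> sets M"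
    unfolding eq by (intro sets.countable_UN') (auto simp: split_beta)
qed

section \<open>Processes with prescribed marginals\<close>

abbreviation "unit_time \<equiv> restrict_space lborel {0..1::real}"

interpretation unit_time: prob_space unit_time
  by (rule prob_space_restrict_lborel_unit)

lemma measure_unit_time: "measure unit_time {0..1} = 1"
  using unit_time.prob_space by (simp add: space_restrict_space)

lemma set_integral_unit_time: "(LINT t:{0..1}|lborel. f t) = (\<integral>t. f t \<partial>unit_time)"
  for f :: "real \<Rightarrow> real"
  by (simp add: integral_restrict_space set_lebesgue_integral_def)

lemma continuous_unit_time:
  fixes f :: "real \<Rightarrow> real"
  assumes "continuous_on {0..1} f"
  shows integrable_unit_time: "integrable unit_time f"
    and integral_unit_time: "(\<integral>t. f t \<partial>unit_time) = integral {0..1} f"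
proof -
  have *: "set_integrable lborel {0..1} f"
    by (rule borel_integrable_atLeastAtMost'[OF assms])
  then show "integrable unit_time f"
    by (simp add: integrable_restrict_space set_integrable_def)
  show "(\<integral>t. f t \<partial>unit_time) = integral {0..1} f"
    using set_borel_integral_eq_integral(2)[OF *] by (simp add: set_integral_unit_time)
qed

lemma integral_unit_time_eq_0:
  fixes f :: "real \<Rightarrow> real"
  assumes "continuous_on {0..1} f" "\<And>t. t \<in> {0..1} \<Longrightarrow> 0 \<le> f t" "(\<integral>t. f t \<partial>unit_time) = 0"
  shows "\<forall>t\<in>{0..1}. f t = 0"
  using integral_eq_0_iff[of 0 1 f] assms by (simp add: integral_unit_time)

lemma max_0_integral_le:
  fixes f :: "real \<Rightarrow> real"
  assumes f: "continuous_on {0..1} f"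
  shows "max 0 (\<integral>t. f t \<partial>unit_time) \<le> (\<integral>t. max 0 (f t) \<partial>unit_time)"
proof -
  have "integrable unit_time f" "integrable unit_time (\<lambda>t. max 0 (f t))"
    using f by (auto intro!: integrable_unit_time continuous_intros)
  then show ?thesis
    by (auto intro!: integral_mono integral_nonneg_AE)
qed

text \<open>If the integral of \<open>f\<close> is nonnegative, the gap between the two sides is the
  integral of the negative part; otherwise equality says that the positive part integrates to 0. By
  continuity a nonnegative function with integral 0 vanishes at every time, not merely almost
  everywhere.\<close>

lemma max_0_integral_eq_iff:
  fixes f :: "real \<Rightarrow> real"
  assumes f: "continuous_on {0..1} f"
  shows "max 0 (\<integral>t. f t \<partial>unit_time) = (\<integral>t. max 0 (f t) \<partial>unit_time) \<longleftrightarrow>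
    (\<forall>t\<in>{0..1}. 0 \<le> f t) \<or> (\<forall>t\<in>{0..1}. f t \<le> 0)"
proof
  assume eq: "max 0 (\<integral>t. f t \<partial>unit_time) = (\<integral>t. max 0 (f t) \<partial>unit_time)"
  have cont: "continuous_on {0..1} (\<lambda>t. max 0 (f t))"
    using f by (intro continuous_intros)
  show "(\<forall>t\<in>{0..1}. 0 \<le> f t) \<or> (\<forall>t\<in>{0..1}. f t \<le> 0)"
  proof (cases "0 \<le> (\<integral>t. f t \<partial>unit_time)")
    case True
    then have "(\<integral>t. max 0 (f t) - f t \<partial>unit_time) = 0"
      using eq integrable_unit_time[OF f] integrable_unit_time[OF cont] by simp
    moreover have "continuous_on {0..1} (\<lambda>t. max 0 (f t) - f t)"
      using f by (intro continuous_intros)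
    ultimately have "\<forall>t\<in>{0..1}. max 0 (f t) - f t = 0"
      by (intro integral_unit_time_eq_0) auto
    then show ?thesis
      by (metis diff_eq_eq add_0 max.cobounded1)
  next
    case False
    then have "\<forall>t\<in>{0..1}. max 0 (f t) = 0"
      using eq cont by (intro integral_unit_time_eq_0) auto
    then show ?thesis
      by (metis max.cobounded2)
  qed
next
  assume "(\<forall>t\<in>{0..1}. 0 \<le> f t) \<or> (\<forall>t\<in>{0..1}. f t \<le> 0)"
  then show "max 0 (\<integral>t. f t \<partial>unit_time) = (\<integral>t. max 0 (f t) \<partial>unit_time)"
  proof
    assume *: "\<forall>t\<in>{0..1}. 0 \<le> f t"
    then have "(\<integral>t. max 0 (f t) \<partial>unit_time) = (\<integral>t. f t \<partial>unit_time)"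
      by (intro Bochner_Integration.integral_cong) (auto simp: space_restrict_space)
    moreover have "0 \<le> (\<integral>t. f t \<partial>unit_time)"
      using * by (intro integral_nonneg_AE AE_I2) (auto simp: space_restrict_space)
    ultimately show ?thesis
      by simp
  next
    assume *: "\<forall>t\<in>{0..1}. f t \<le> 0"
    then have "(\<integral>t. max 0 (f t) \<partial>unit_time) = (\<integral>t. 0 \<partial>unit_time)"
      by (intro Bochner_Integration.integral_cong) (auto simp: space_restrict_space max_absorb1)
    moreover have "0 \<le> (\<integral>t. - f t \<partial>unit_time)"
      using * by (intro integral_nonneg_AE AE_I2) (auto simp: space_restrict_space)
    ultimately show ?thesis
      by simp
  qed
qed

locale marginal_process = quantile_path +
  fixes M :: "'w measure" and X :: "real \<Rightarrow> 'w \<Rightarrow> real"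
  assumes process: "(M, X) \<in> processes_with_marginals \<mu>"
begin

sublocale prob_space M
  using process by (simp add: processes_with_marginals_def continuous_process_def)

sublocale pair: pair_sigma_finite unit_time M ..

lemma continuous_path: "\<omega> \<in> space M \<Longrightarrow> continuous_on {0..1} (\<lambda>t. X t \<omega>)"
  using process by (simp add: processes_with_marginals_def continuous_process_def)

lemma marginal: "t \<in> {0..1} \<Longrightarrow> distr M borel (X t) = \<mu> t"
  using process by (simp add: processes_with_marginals_def)

lemma measurable_process [measurable]:
  "(\<lambda>p. X (fst p) (snd p)) \<in> borel_measurable (unit_time \<Otimes>\<^sub>M M)"
proof -
  have "sets (unit_time \<Otimes>\<^sub>M M) = sets (restrict_space borel {0..1} \<Otimes>\<^sub>M M)"
    by (intro sets_pair_measure_cong) (auto simp: sets_restrict_space)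
  then show ?thesis
    using process
    by (simp add: processes_with_marginals_def continuous_process_def split_beta' cong: measurable_cong_sets)
qed

lemma measurable_process_compose [measurable (raw)]:
  "f \<in> measurable N unit_time \<Longrightarrow> g \<in> measurable N M \<Longrightarrow> (\<lambda>x. X (f x) (g x)) \<in> borel_measurable N"
  using measurable_compose[OF measurable_Pair measurable_process, of f N g] by simp

lemma measurable_marginal: "t \<in> {0..1} \<Longrightarrow> X t \<in> borel_measurable M"
  using measurable_compose[OF measurable_Pair1' measurable_process, of t]
  by (simp add: space_restrict_space)

text \<open>Tonelli turns the expected time integral into a functional of the marginals. The
  integrand \<phi> may depend on time so that moving strikes \<open>c t\<close> are covered.\<close>

lemma nn_integral_process:
  fixes \<phi> :: "real \<Rightarrow> real \<Rightarrow> ennreal"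
  assumes \<phi>: "(\<lambda>p. \<phi> (fst p) (snd p)) \<in> borel_measurable (unit_time \<Otimes>\<^sub>M borel)"
  shows "(\<integral>\<^sup>+\<omega>. \<integral>\<^sup>+t. \<phi> t (X t \<omega>) \<partial>unit_time \<partial>M) = (\<integral>\<^sup>+t. \<integral>\<^sup>+x. \<phi> t x \<partial>\<mu> t \<partial>unit_time)"
proof -
  have "(\<lambda>p. (fst p, X (fst p) (snd p))) \<in> measurable (unit_time \<Otimes>\<^sub>M M) (unit_time \<Otimes>\<^sub>M borel)"
    by measurable
  from measurable_compose[OF this \<phi>]
  have "(\<integral>\<^sup>+\<omega>. \<integral>\<^sup>+t. \<phi> t (X t \<omega>) \<partial>unit_time \<partial>M) = (\<integral>\<^sup>+t. \<integral>\<^sup>+\<omega>. \<phi> t (X t \<omega>) \<partial>M \<partial>unit_time)"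
    by (intro pair.Fubini') (simp add: split_beta')
  also have "\<dots> = (\<integral>\<^sup>+t. \<integral>\<^sup>+x. \<phi> t x \<partial>\<mu> t \<partial>unit_time)"
  proof (intro nn_integral_cong)
    fix t assume "t \<in> space unit_time"
    then have t: "t \<in> {0..1}" by (simp add: space_restrict_space)
    have "\<phi> t \<in> borel_measurable borel"
      using measurable_compose[OF measurable_Pair1' \<phi>, of t] t by (simp add: space_restrict_space)
    then show "(\<integral>\<^sup>+\<omega>. \<phi> t (X t \<omega>) \<partial>M) = (\<integral>\<^sup>+x. \<phi> t x \<partial>\<mu> t)"
      using measurable_marginal[OF t] unfolding marginal[OF t, symmetric]
      by (simp add: nn_integral_distr)
  qed
  finally show ?thesis .
qed

lemma measurable_path_process: "(\<lambda>\<omega>. \<lambda>t\<in>{0..1}. X t \<omega>) \<in> measurable M path_space"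
  by (intro measurable_path measurable_marginal continuous_path)

end

text \<open>Stronger than integrability of the means over time, which allows cancellation. It is
  what makes a process integrable on the product space.\<close>

locale integrable_quantile_path = quantile_path +
  assumes finite_first_moment: "(\<integral>\<^sup>+t. \<integral>\<^sup>+x. ennreal \<bar>x\<bar> \<partial>\<mu> t \<partial>unit_time) < \<infinity>"

locale integrable_process = integrable_quantile_path + marginal_process
begin

lemma integrable_pair: "integrable (unit_time \<Otimes>\<^sub>M M) (\<lambda>(t, \<omega>). X t \<omega>)"
proof (rule integrableI_bounded)
  show "(\<lambda>(t, \<omega>). X t \<omega>) \<in> borel_measurable (unit_time \<Otimes>\<^sub>M M)"
    by (simp add: split_beta')
  have "(\<integral>\<^sup>+p. ennreal (norm (case p of (t, \<omega>) \<Rightarrow> X t \<omega>)) \<partial>(unit_time \<Otimes>\<^sub>M M))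
      = (\<integral>\<^sup>+\<omega>. \<integral>\<^sup>+t. ennreal \<bar>X t \<omega>\<bar> \<partial>unit_time \<partial>M)"
    by (subst pair.nn_integral_snd[symmetric]) (simp_all add: split_beta')
  also have "\<dots> = (\<integral>\<^sup>+t. \<integral>\<^sup>+x. ennreal \<bar>x\<bar> \<partial>\<mu> t \<partial>unit_time)"
    by (intro nn_integral_process) measurable
  finally show "(\<integral>\<^sup>+p. ennreal (norm (case p of (t, \<omega>) \<Rightarrow> X t \<omega>)) \<partial>(unit_time \<Otimes>\<^sub>M M)) < \<infinity>"
    using finite_first_moment by simp
qed

definition "average \<omega> = (\<integral>t. X t \<omega> \<partial>unit_time)"

lemma integrable_average: "integrable M average"
  unfolding average_def[abs_def] by (rule pair.integrable_snd[OF integrable_pair])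

lemma expectation_average: "expectation average = (\<integral>t. \<integral>x. x \<partial>\<mu> t \<partial>unit_time)"
proof -
  have "expectation average = (\<integral>t. \<integral>\<omega>. X t \<omega> \<partial>M \<partial>unit_time)"
    unfolding average_def[abs_def] by (rule pair.Fubini_integral[OF integrable_pair])
  also have "\<dots> = (\<integral>t. \<integral>x. x \<partial>\<mu> t \<partial>unit_time)"
    using measurable_marginal
    by (intro Bochner_Integration.integral_cong)
       (auto simp: space_restrict_space integral_distr simp flip: marginal)
  finally show ?thesis .
qed

text \<open>The expected value is written through \<mu> alone, so that it is literally the same
  number for every process with these marginals. The bound by the time averages of
  \<open>\<bar>X t \<omega>\<bar>\<close> and \<open>\<bar>c t\<bar>\<close> makes it
  finite.\<close>

lemma spread_process:
  assumes c: "continuous_on {0..1} c"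
  shows integrable_spread: "integrable M (\<lambda>\<omega>. \<integral>t. max 0 (X t \<omega> - c t) \<partial>unit_time)"
    and expectation_spread: "expectation (\<lambda>\<omega>. \<integral>t. max 0 (X t \<omega> - c t) \<partial>unit_time) =
      enn2real (\<integral>\<^sup>+t. \<integral>\<^sup>+x. ennreal (max 0 (x - c t)) \<partial>\<mu> t \<partial>unit_time)"
proof -
  have c_meas [measurable]: "c \<in> borel_measurable unit_time"
    using integrable_unit_time[OF c] by simp
  have meas [measurable]: "(\<lambda>\<omega>. \<integral>t. max 0 (X t \<omega> - c t) \<partial>unit_time) \<in> borel_measurable M"
    by measurable
  have X_int: "integrable unit_time (\<lambda>t. X t \<omega>)" if "\<omega> \<in> space M" for \<omega>
    using continuous_path[OF that] by (rule integrable_unit_time)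
  have c_int: "integrable unit_time c"
    using c by (rule integrable_unit_time)
  show "integrable M (\<lambda>\<omega>. \<integral>t. max 0 (X t \<omega> - c t) \<partial>unit_time)"
  proof (rule Bochner_Integration.integrable_bound)
    show "integrable M (\<lambda>\<omega>. (\<integral>t. \<bar>X t \<omega>\<bar> \<partial>unit_time) + (\<integral>t. \<bar>c t\<bar> \<partial>unit_time))"
      using pair.integrable_snd[of "\<lambda>t \<omega>. \<bar>X t \<omega>\<bar>"] integrable_abs[OF integrable_pair]
      by (simp add: split_beta')
    show "AE \<omega> in M. norm (\<integral>t. max 0 (X t \<omega> - c t) \<partial>unit_time)
        \<le> norm ((\<integral>t. \<bar>X t \<omega>\<bar> \<partial>unit_time) + (\<integral>t. \<bar>c t\<bar> \<partial>unit_time))"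
    proof (rule AE_I2)
      fix \<omega> assume \<omega>: "\<omega> \<in> space M"
      have "(\<integral>t. max 0 (X t \<omega> - c t) \<partial>unit_time) \<le> (\<integral>t. \<bar>X t \<omega>\<bar> + \<bar>c t\<bar> \<partial>unit_time)"
        using X_int[OF \<omega>] c_int by (intro integral_mono) auto
      moreover have "0 \<le> (\<integral>t. max 0 (X t \<omega> - c t) \<partial>unit_time)"
        by (intro integral_nonneg_AE) auto
      ultimately show "norm (\<integral>t. max 0 (X t \<omega> - c t) \<partial>unit_time)
          \<le> norm ((\<integral>t. \<bar>X t \<omega>\<bar> \<partial>unit_time) + (\<integral>t. \<bar>c t\<bar> \<partial>unit_time))"
        using X_int[OF \<omega>] c_int by simp
    qed
  qed measurable
  have "expectation (\<lambda>\<omega>. \<integral>t. max 0 (X t \<omega> - c t) \<partial>unit_time)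
      = enn2real (\<integral>\<^sup>+\<omega>. ennreal (\<integral>t. max 0 (X t \<omega> - c t) \<partial>unit_time) \<partial>M)"
    by (intro integral_eq_nn_integral) (auto intro!: integral_nonneg_AE)
  also have "(\<integral>\<^sup>+\<omega>. ennreal (\<integral>t. max 0 (X t \<omega> - c t) \<partial>unit_time) \<partial>M)
      = (\<integral>\<^sup>+\<omega>. \<integral>\<^sup>+t. ennreal (max 0 (X t \<omega> - c t)) \<partial>unit_time \<partial>M)"
    using X_int c_int by (intro nn_integral_cong nn_integral_eq_integral[symmetric]) auto
  also have "\<dots> = (\<integral>\<^sup>+t. \<integral>\<^sup>+x. ennreal (max 0 (x - c t)) \<partial>\<mu> t \<partial>unit_time)"
    by (intro nn_integral_process) measurable
  finally show "expectation (\<lambda>\<omega>. \<integral>t. max 0 (X t \<omega> - c t) \<partial>unit_time) =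
      enn2real (\<integral>\<^sup>+t. \<integral>\<^sup>+x. ennreal (max 0 (x - c t)) \<partial>\<mu> t \<partial>unit_time)" .
qed

lemma average_minus:
  assumes "continuous_on {0..1} c" "\<omega> \<in> space M"
  shows "average \<omega> - (\<integral>t. c t \<partial>unit_time) = (\<integral>t. X t \<omega> - c t \<partial>unit_time)"
  unfolding average_def
  using integrable_unit_time[OF assms(1)] integrable_unit_time[OF continuous_path[OF assms(2)]] by simp

lemma call_average_le_spread:
  assumes c: "continuous_on {0..1} c" and \<omega>: "\<omega> \<in> space M"
  shows "max 0 (average \<omega> - (\<integral>t. c t \<partial>unit_time)) \<le> (\<integral>t. max 0 (X t \<omega> - c t) \<partial>unit_time)"
  unfolding average_minus[OF assms]
  by (intro max_0_integral_le continuous_intros c continuous_path \<omega>)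

lemma integrable_call: "integrable M (\<lambda>\<omega>. max 0 (average \<omega> - k))"
  using integrable_average by auto

end

section \<open>Convex order of the time averages\<close>

text \<open>The quantile process is itself an admissible process, so each fact about a competitor
  has a copy for it under the prefix \<open>opt\<close>. All comparisons are made between the two
  copies.\<close>

sublocale integrable_quantile_path \<subseteq> opt: integrable_process \<mu> opt_space "opt_process \<mu>"
  by unfold_locales (rule opt_process_in)

context integrable_quantile_path
begin

lemma space_opt_space: "space opt_space = {0<..<1}"
  by (simp add: opt_space_def space_restrict_space)

lemma opt_process_mono:
  assumes "t \<in> {0..1}" "0 < p" "p \<le> q" "q < 1"
  shows "opt_process \<mu> t p \<le> opt_process \<mu> t q"
  unfolding opt_process_def
  using interval_distribution.cdf_inverse_mono[OF interval_distribution] assms by auto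

lemma opt_average_mono:
  assumes "0 < p" "p \<le> q" "q < 1"
  shows "opt.average p \<le> opt.average q"
  unfolding opt.average_def using assms
  by (intro integral_mono integrable_unit_time continuous_on_opt_process opt_process_mono)
     (auto simp: space_restrict_space)

text \<open>Makes the set of averages an interval, so that every strike strictly between two
  averages is itself an average. Compactness of the time interval allows the limit under the
  integral.\<close>

lemma continuous_on_opt_average: "continuous_on {0<..<1} opt.average"
proof -
  have "continuous_on ({0<..<1} \<times> cbox 0 1) (\<lambda>(q, t). opt_process \<mu> t q)"
    using continuous_on_compose2[OF continuous_on_quantile, of "{0<..<1} \<times> cbox 0 1" prod.swap]
    by (force simp: opt_process_def split_beta' continuous_on_swap)
  then have "continuous_on {0<..<1} (\<lambda>q. integral {0..1} (\<lambda>t. opt_process \<mu> t q))"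
    using integral_continuous_on_param by fastforce
  then show ?thesis
    unfolding opt.average_def[abs_def]
    by (rule continuous_on_eq) (simp add: integral_unit_time continuous_on_opt_process)
qed

lemma opt_call_eq_spread:
  assumes q: "q \<in> {0<..<1}"
  shows "opt.expectation (\<lambda>p. max 0 (opt.average p - opt.average q)) =
    enn2real (\<integral>\<^sup>+t. \<integral>\<^sup>+x. ennreal (max 0 (x - opt_process \<mu> t q)) \<partial>\<mu> t \<partial>unit_time)"
proof -
  have "opt.expectation (\<lambda>p. max 0 (opt.average p - opt.average q)) =
      opt.expectation (\<lambda>p. \<integral>t. max 0 (opt_process \<mu> t p - opt_process \<mu> t q) \<partial>unit_time)"
  proof (rule Bochner_Integration.integral_cong[OF refl])
    fix p assume "p \<in> space opt_space"
    then have p: "p \<in> {0<..<1}" by (simp add: space_opt_space)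
    show "max 0 (opt.average p - opt.average q) =
        (\<integral>t. max 0 (opt_process \<mu> t p - opt_process \<mu> t q) \<partial>unit_time)"
      \<comment> \<open>The difference of the quantile paths of levels \<open>p\<close> and
        \<open>q\<close> has one sign at all times, decided by the order of \<open>p\<close> and
        \<open>q\<close>.\<close>
      unfolding opt.average_def[of q]
      using p q opt_process_mono[of _ p q] opt_process_mono[of _ q p] linear[of p q]
      by (subst opt.average_minus)
         (auto simp: space_opt_space max_0_integral_eq_iff continuous_on_opt_process
               intro!: max_0_integral_eq_iff[THEN iffD2] continuous_intros)
  qed
  then show ?thesis
    using opt.expectation_spread[OF continuous_on_opt_process[OF q]] by simp
qed

end

section \<open>Comparison of call prices with the quantile process\<close>

context integrable_process
begin

lemma call_at_opt_average_le:
  assumes q: "q \<in> {0<..<1}"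
  shows "expectation (\<lambda>\<omega>. max 0 (average \<omega> - opt.average q))
      \<le> opt.expectation (\<lambda>p. max 0 (opt.average p - opt.average q))"
proof -
  note c = continuous_on_opt_process[OF q]
  have "expectation (\<lambda>\<omega>. max 0 (average \<omega> - opt.average q))
      \<le> expectation (\<lambda>\<omega>. \<integral>t. max 0 (X t \<omega> - opt_process \<mu> t q) \<partial>unit_time)"
    unfolding opt.average_def
    by (intro integral_mono integrable_call integrable_spread[OF c] call_average_le_spread[OF c])
  then show ?thesis
    using expectation_spread[OF c] opt_call_eq_spread[OF q] by simp
qed

text \<open>A pointwise inequality between integrable functions with equal expectations is almost
  surely an equality. Equality for a single path means, by \<open>max_0_integral_eq_iff\<close>,
  that its difference from the quantile path does not change sign.\<close>

lemma call_at_opt_average_eqD: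
  assumes q: "q \<in> {0<..<1}"
    and eq: "expectation (\<lambda>\<omega>. max 0 (average \<omega> - opt.average q))
      = opt.expectation (\<lambda>p. max 0 (opt.average p - opt.average q))"
  shows "AE \<omega> in M. (\<forall>t\<in>{0..1}. opt_process \<mu> t q \<le> X t \<omega>) \<or> (\<forall>t\<in>{0..1}. X t \<omega> \<le> opt_process \<mu> t q)"
proof -
  note c = continuous_on_opt_process[OF q]
  have "AE \<omega> in M. max 0 (average \<omega> - opt.average q)
      = (\<integral>t. max 0 (X t \<omega> - opt_process \<mu> t q) \<partial>unit_time)"
  proof (rule integral_ineq_eq_0_then_AE)
    show "AE \<omega> in M. max 0 (average \<omega> - opt.average q)
        \<le> (\<integral>t. max 0 (X t \<omega> - opt_process \<mu> t q) \<partial>unit_time)"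
      unfolding opt.average_def by (intro AE_I2 call_average_le_spread[OF c])
    show "expectation (\<lambda>\<omega>. max 0 (average \<omega> - opt.average q))
        = expectation (\<lambda>\<omega>. \<integral>t. max 0 (X t \<omega> - opt_process \<mu> t q) \<partial>unit_time)"
      using expectation_spread[OF c] opt_call_eq_spread[OF q] eq by simp
  qed (intro integrable_call integrable_spread[OF c])+
  then show ?thesis
  proof (rule AE_mp, intro AE_I2 impI)
    fix \<omega> assume \<omega>: "\<omega> \<in> space M"
      and "max 0 (average \<omega> - opt.average q) = (\<integral>t. max 0 (X t \<omega> - opt_process \<mu> t q) \<partial>unit_time)"
    then have "max 0 (\<integral>t. X t \<omega> - opt_process \<mu> t q \<partial>unit_time)
        = (\<integral>t. max 0 (X t \<omega> - opt_process \<mu> t q) \<partial>unit_time)"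
      unfolding opt.average_def average_minus[OF c \<omega>] by simp
    then show "(\<forall>t\<in>{0..1}. opt_process \<mu> t q \<le> X t \<omega>) \<or> (\<forall>t\<in>{0..1}. X t \<omega> \<le> opt_process \<mu> t q)"
      using c continuous_path[OF \<omega>] by (subst (asm) max_0_integral_eq_iff) (auto intro!: continuous_intros)
  qed
qed

lemma expectation_average_opt: "opt.expectation opt.average = expectation average"
  by (simp add: expectation_average opt.expectation_average)

text \<open>The range is connected, but its end points need not be attained: the two strict cases
  include strikes equal to its supremum or infimum.\<close>

lemma opt_average_range_cases:
  obtains q where "q \<in> {0<..<1}" "k = opt.average q"
  | "\<And>q. q \<in> {0<..<1} \<Longrightarrow> opt.average q < k"
  | "\<And>q. q \<in> {0<..<1} \<Longrightarrow> k < opt.average q"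
proof -
  have "connected (opt.average ` {0<..<1})"
    by (intro connected_continuous_image continuous_on_opt_average) simp
  then have between: "k \<in> opt.average ` {0<..<1}"
    if pq: "p \<in> {0<..<1}" "q \<in> {0<..<1}" "opt.average p < k" "k < opt.average q" for p q
    using connectedD_interval[OF _ imageI[OF pq(1)] imageI[OF pq(2)], of opt.average k] pq(3,4)
    by (meson less_imp_le)
  show thesis
  proof (cases "k \<in> opt.average ` {0<..<1}")
    case True
    then show thesis
      using that(1) by blast
  next
    case False
    show thesis
    proof (cases "\<exists>p\<in>{0<..<1}. opt.average p < k")
      case True
      then obtain p where p: "p \<in> {0<..<1}" "opt.average p < k" by blast
      have "opt.average q < k" if "q \<in> {0<..<1}" for q
        using between[OF p(1) that p(2)] False that by (metis image_eqI linorder_neqE)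
      then show thesis
        using that(2) by blast
    next
      assume "\<not> (\<exists>p\<in>{0<..<1}. opt.average p < k)"
      then have "k < opt.average q" if "q \<in> {0<..<1}" for q
        using False that by (metis image_eqI linorder_neqE)
      then show thesis
        using that(3) by blast
    qed
  qed
qed

text \<open>Serves for the tail sets of levels near 0 or near 1, whose small length forces the
  option prices there to vanish in the limit.\<close>

lemma integral_opt_le_of_bound:
  assumes f: "integrable opt_space f" and A: "A \<subseteq> {0<..<1}" "A \<in> sets borel"
    and le: "\<And>p. p \<in> {0<..<1} \<Longrightarrow> f p \<le> b * indicator A p"
  shows "opt.expectation f \<le> b * measure lborel A"
proof -
  have A': "A \<in> sets opt_space"
    using A by (simp add: opt_space_def sets_restrict_space_iff)
  then have "opt.expectation f \<le> opt.expectation (\<lambda>p. b * indicator A p)"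
    using f le by (intro integral_mono) (auto simp: space_opt_space opt.emeasure_eq_measure)
  also have "\<dots> = b * measure opt_space A"
    using A A' by (simp add: space_opt_space Int_absorb2)
  also have "measure opt_space A = measure lborel A"
    unfolding opt_space_def using A by (intro measure_restrict_space) auto
  finally show ?thesis .
qed

text \<open>An attained strike is immediate. If \<open>k\<close> lies above all averages, lowering
  it to \<open>opt.average q\<close> only raises the call price; the comparison call then pays only
  on levels above \<open>q\<close>, and its price tends to 0 as \<open>q\<close> tends to 1. If
  \<open>k\<close> lies below, the same is done with puts and \<open>q\<close> tending to 0.\<close>

theorem call_average_le_opt:
  "expectation (\<lambda>\<omega>. max 0 (average \<omega> - k)) \<le> opt.expectation (\<lambda>p. max 0 (opt.average p - k))"
proof (cases rule: opt_average_range_cases[of k])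
  case (1 q)
  then show ?thesis
    using call_at_opt_average_le by simp
next
  case 2
  \<comment> \<open>The level \<open>1 / 2\<close> is an arbitrary fixed reference: for
    \<open>q\<close> above it, the payment is at most \<open>k - opt.average (1 / 2)\<close>, a
    bound independent of \<open>q\<close>.\<close>
  have "expectation (\<lambda>\<omega>. max 0 (average \<omega> - k)) \<le> (k - opt.average (1 / 2)) * (1 - q)"
    if q: "1 / 2 < q" "q < 1" for q
  proof -
    have "expectation (\<lambda>\<omega>. max 0 (average \<omega> - k)) \<le> expectation (\<lambda>\<omega>. max 0 (average \<omega> - opt.average q))"
      using 2[of q] q by (intro integral_mono integrable_call) auto
    also have "\<dots> \<le> opt.expectation (\<lambda>p. max 0 (opt.average p - opt.average q))"
      using q by (intro call_at_opt_average_le) auto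
    also have "\<dots> \<le> (k - opt.average (1 / 2)) * measure lborel {q<..<1}"
    proof (intro integral_opt_le_of_bound opt.integrable_call)
      fix p :: real assume "p \<in> {0<..<1}"
      then show "max 0 (opt.average p - opt.average q) \<le> (k - opt.average (1 / 2)) * indicator {q<..<1} p"
        using 2[of p] 2[of q] q opt_average_mono[of p q] opt_average_mono[of "1 / 2" q]
        by (cases "q < p") simp_all
    qed (use q in auto)
    finally show ?thesis
      using q by simp
  qed
  then have "eventually (\<lambda>q. expectation (\<lambda>\<omega>. max 0 (average \<omega> - k))
      \<le> (k - opt.average (1 / 2)) * (1 - q)) (at_left 1)"
    using eventually_at_left_real[of "1 / 2" "1 :: real"] by (auto elim: eventually_mono)
  moreover have "((\<lambda>q. (k - opt.average (1 / 2)) * (1 - q)) \<longlongrightarrow> (k - opt.average (1 / 2)) * (1 - 1)) (at_left (1::real))"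
    by (intro tendsto_intros)
  ultimately have "expectation (\<lambda>\<omega>. max 0 (average \<omega> - k)) \<le> 0"
    using tendsto_lowerbound by fastforce
  also have "0 \<le> opt.expectation (\<lambda>p. max 0 (opt.average p - k))"
    by (intro integral_nonneg_AE) auto
  finally show ?thesis .
next
  case 3
  have int: "integrable M (\<lambda>\<omega>. max 0 (a - average \<omega>))" for a
    using integrable_average by auto
  \<comment> \<open>Put-call parity. As the means of the two averages agree, comparing calls is the
    same as comparing puts.\<close>
  have split: "expectation (\<lambda>\<omega>. max 0 (average \<omega> - a)) =
      expectation average - a + expectation (\<lambda>\<omega>. max 0 (a - average \<omega>))" for a
  proof -
    have "expectation (\<lambda>\<omega>. max 0 (average \<omega> - a)) =
        expectation (\<lambda>\<omega>. (average \<omega> - a) + max 0 (a - average \<omega>))"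
      by (intro Bochner_Integration.integral_cong) auto
    also have "\<dots> = expectation (\<lambda>\<omega>. average \<omega> - a) + expectation (\<lambda>\<omega>. max 0 (a - average \<omega>))"
      using int integrable_average by (intro Bochner_Integration.integral_add) auto
    finally show ?thesis
      using integrable_average by (simp add: prob_space)
  qed
  have opt_int: "integrable opt_space (\<lambda>p. max 0 (a - opt.average p))" for a
    using opt.integrable_average by auto
  have opt_split: "opt.expectation (\<lambda>p. max 0 (opt.average p - a)) =
      opt.expectation opt.average - a + opt.expectation (\<lambda>p. max 0 (a - opt.average p))" for a
  proof -
    have "opt.expectation (\<lambda>p. max 0 (opt.average p - a)) =
        opt.expectation (\<lambda>p. (opt.average p - a) + max 0 (a - opt.average p))"
      by (intro Bochner_Integration.integral_cong) auto
    also have "\<dots> = opt.expectation (\<lambda>p. opt.average p - a) + opt.expectation (\<lambda>p. max 0 (a - opt.average p))"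
      using opt_int opt.integrable_average by (intro Bochner_Integration.integral_add) auto
    finally show ?thesis
      using opt.integrable_average by (simp add: opt.prob_space)
  qed
  have "expectation (\<lambda>\<omega>. max 0 (k - average \<omega>)) \<le> (opt.average (1 / 2) - k) * q"
    if q: "0 < q" "q < 1 / 2" for q
  proof -
    have "expectation (\<lambda>\<omega>. max 0 (k - average \<omega>)) \<le> expectation (\<lambda>\<omega>. max 0 (opt.average q - average \<omega>))"
      using 3[of q] q by (intro integral_mono int) auto
    also have "\<dots> \<le> opt.expectation (\<lambda>p. max 0 (opt.average q - opt.average p))"
      using call_at_opt_average_le[of q] q expectation_average_opt by (simp add: split opt_split)
    also have "\<dots> \<le> (opt.average (1 / 2) - k) * measure lborel {0<..<q}"
    proof (intro integral_opt_le_of_bound opt_int)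
      fix p :: real assume "p \<in> {0<..<1}"
      then show "max 0 (opt.average q - opt.average p) \<le> (opt.average (1 / 2) - k) * indicator {0<..<q} p"
        using 3[of p] 3[of q] q opt_average_mono[of q p] opt_average_mono[of q "1 / 2"]
        by (cases "p < q") simp_all
    qed (use q in auto)
    finally show ?thesis
      using q by simp
  qed
  then have "eventually (\<lambda>q. expectation (\<lambda>\<omega>. max 0 (k - average \<omega>))
      \<le> (opt.average (1 / 2) - k) * q) (at_right 0)"
    using eventually_at_right_real[of 0 "1 / 2 :: real"] by (auto elim: eventually_mono)
  moreover have "((\<lambda>q. (opt.average (1 / 2) - k) * q) \<longlongrightarrow> (opt.average (1 / 2) - k) * 0) (at_right (0::real))"
    by (intro tendsto_intros)
  ultimately have "expectation (\<lambda>\<omega>. max 0 (k - average \<omega>)) \<le> 0"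
    using tendsto_lowerbound by fastforce
  also have "0 \<le> opt.expectation (\<lambda>p. max 0 (k - opt.average p))"
    by (intro integral_nonneg_AE) auto
  finally show ?thesis
    using expectation_average_opt by (simp add: split opt_split)
qed

text \<open>If the path does not cross any quantile path of rational level, then its level
  \<open>cdf (\<mu> t) (X t \<omega>)\<close> cannot depend on \<open>t\<close>.\<close>

lemma AE_path_eq_quantile_path:
  assumes eq: "\<And>q. q \<in> {0<..<1} \<Longrightarrow> expectation (\<lambda>\<omega>. max 0 (average \<omega> - opt.average q))
      = opt.expectation (\<lambda>p. max 0 (opt.average p - opt.average q))"
  shows "AE \<omega> in M. cdf (\<mu> 0) (X 0 \<omega>) \<in> {0<..<1} \<and>
    (\<forall>t\<in>{0..1}. X t \<omega> = opt_process \<mu> t (cdf (\<mu> 0) (X 0 \<omega>)))"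
proof -
  have "AE \<omega> in M. \<forall>q\<in>{0<..<1} \<inter> \<rat>.
      (\<forall>t\<in>{0..1}. opt_process \<mu> t q \<le> X t \<omega>) \<or> (\<forall>t\<in>{0..1}. X t \<omega> \<le> opt_process \<mu> t q)"
  proof (rule AE_ball_countable')
    show "AE \<omega> in M. (\<forall>t\<in>{0..1}. opt_process \<mu> t q \<le> X t \<omega>) \<or> (\<forall>t\<in>{0..1}. X t \<omega> \<le> opt_process \<mu> t q)"
      if "q \<in> {0<..<1} \<inter> \<rat>" for q
    proof -
      have q: "q \<in> {0<..<1}" using that by blast
      show ?thesis by (rule call_at_opt_average_eqD[OF q eq[OF q]])
    qed
    show "countable ({0<..<1} \<inter> \<rat> :: real set)"
      by (intro countable_Int2 countable_rat)
  qed
  \<comment> \<open>This event depends only on the marginal at time 0, so it may be checked for the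
    quantile process, where the level is \<open>p\<close> itself.\<close>
  moreover have "AE \<omega> in M. cdf (\<mu> 0) (X 0 \<omega>) \<in> {0<..<1}"
  proof -
    interpret \<mu>0: interval_distribution "\<mu> 0"
      by (rule interval_distribution) simp
    have meas: "{x \<in> space borel. cdf (\<mu> 0) x \<in> {0<..<1}} \<in> sets borel"
    proof -
      have [measurable]: "cdf (\<mu> 0) \<in> borel_measurable borel"
        by (intro borel_measurable_mono) (auto simp: mono_def \<mu>0.cdf_nondecreasing)
      show ?thesis by measurable
    qed
    have "AE p in opt_space. cdf (\<mu> 0) (opt_process \<mu> 0 p) \<in> {0<..<1}"
      by (rule AE_I2) (simp add: space_opt_space opt_process_def \<mu>0.cdf_cdf_inverse)
    then have "AE x in distr opt_space borel (opt_process \<mu> 0). cdf (\<mu> 0) x \<in> {0<..<1}"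
      by (rule AE_distr_iff[OF opt.measurable_marginal meas, THEN iffD2, rotated]) simp
    then have "AE x in distr M borel (X 0). cdf (\<mu> 0) x \<in> {0<..<1}"
      by (simp only: marginal opt.marginal atLeastAtMost_iff order_refl zero_le_one simp_thms)
    then show ?thesis
      by (rule AE_distr_iff[OF measurable_marginal meas, THEN iffD1, rotated]) simp
  qed
  ultimately show ?thesis
  proof eventually_elim
    case (elim \<omega>)
    have level_le: "cdf (\<mu> t) (X t \<omega>) \<le> cdf (\<mu> s) (X s \<omega>)" if ts: "t \<in> {0..1}" "s \<in> {0..1}" for t s
    proof (rule ccontr)
      interpret t: interval_distribution "\<mu> t" using ts(1) by (rule interval_distribution)
      interpret s: interval_distribution "\<mu> s" using ts(2) by (rule interval_distribution)
      assume "\<not> ?thesis"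
      \<comment> \<open>A rational level between the two puts the path below the quantile path at
        \<open>s\<close> and above it at \<open>t\<close>, a forbidden crossing.\<close>
      then obtain q where q: "q \<in> \<rat>" "cdf (\<mu> s) (X s \<omega>) < q" "q < cdf (\<mu> t) (X t \<omega>)"
        using Rats_dense_in_real[of "cdf (\<mu> s) (X s \<omega>)" "cdf (\<mu> t) (X t \<omega>)"] by auto
      have q01: "0 < q" "q < 1"
        using q s.cdf_nonneg[of "X s \<omega>"] t.cdf_bounded_prob[of "X t \<omega>"] by auto
      have "X s \<omega> < opt_process \<mu> s q" "opt_process \<mu> t q < X t \<omega>"
        unfolding opt_process_def
        using q q01 by (auto simp: s.less_cdf_inverse_iff t.cdf_inverse_less_iff)
      then show False
        using elim(1) q(1) q01 ts by (meson IntI greaterThanLessThan_iff not_le)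
    qed
    have "X t \<omega> = opt_process \<mu> t (cdf (\<mu> 0) (X 0 \<omega>))" if t: "t \<in> {0..1}" for t
    proof -
      interpret t: interval_distribution "\<mu> t" using t by (rule interval_distribution)
      have "cdf (\<mu> 0) (X 0 \<omega>) = cdf (\<mu> t) (X t \<omega>)"
        using level_le[of 0 t] level_le[of t 0] t by (intro antisym) auto
      then show ?thesis
        using elim(2) by (simp add: opt_process_def t.cdf_inverse_cdf)
    qed
    with elim(2) show ?case by blast
  qed
qed

text \<open>Almost surely the path of \<open>X\<close> is the image of the level read off at time 0
  under the map from levels to quantile paths. Once that level is known to be uniform, both path
  laws are the image of \<open>opt_space\<close> under the same map.\<close>

theorem path_law_eq_of_call_eq:
  assumes eq: "\<And>q. q \<in> {0<..<1} \<Longrightarrow> expectation (\<lambda>\<omega>. max 0 (average \<omega> - opt.average q))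
      = opt.expectation (\<lambda>p. max 0 (opt.average p - opt.average q))"
  shows "path_law M X = path_law opt_space (opt_process \<mu>)"
proof -
  interpret \<mu>0: interval_distribution "\<mu> 0"
    by (rule interval_distribution) simp
  \<comment> \<open>The value \<open>1 / 2\<close> only ensures that \<psi> always lands in
    \<open>opt_space\<close>; it is taken with probability 0 outside the first case.\<close>
  define \<psi> where "\<psi> x = (if cdf (\<mu> 0) x \<in> {0<..<1} then cdf (\<mu> 0) x else 1 / 2)" for x
  let ?P = "\<lambda>\<omega>. \<lambda>t\<in>{0..1}. X t \<omega>" and ?O = "\<lambda>q. \<lambda>t\<in>{0..1}. opt_process \<mu> t q"
  have \<psi>: "\<psi> \<in> measurable borel opt_space"
  proof -
    have [measurable]: "cdf (\<mu> 0) \<in> borel_measurable borel"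
      by (intro borel_measurable_mono) (auto simp: mono_def \<mu>0.cdf_nondecreasing)
    have "\<psi> \<in> borel_measurable borel"
      unfolding \<psi>_def[abs_def] by measurable
    then show ?thesis
      unfolding opt_space_def by (intro measurable_restrict_space2) (auto simp: \<psi>_def)
  qed
  have X0: "X 0 \<in> borel_measurable M" and O0: "opt_process \<mu> 0 \<in> borel_measurable opt_space"
    by (auto intro: measurable_marginal opt.measurable_marginal)
  \<comment> \<open>No computation with distribution functions is needed: \<open>\<mu> 0\<close> is
    also the law of \<open>opt_process \<mu> 0\<close>, which \<psi> undoes.\<close>
  have "distr M opt_space (\<lambda>\<omega>. \<psi> (X 0 \<omega>)) = distr (\<mu> 0) opt_space \<psi>"
    using distr_distr[OF \<psi> X0] marginal[of 0] by (simp add: comp_def)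
  also have "\<dots> = distr opt_space opt_space (\<lambda>q. \<psi> (opt_process \<mu> 0 q))"
    using distr_distr[OF \<psi> O0] distr_opt_process[of 0] by (simp add: comp_def)
  also have "\<dots> = distr opt_space opt_space (\<lambda>q. q)"
    by (intro distr_cong) (auto simp: \<psi>_def space_opt_space opt_process_def \<mu>0.cdf_cdf_inverse)
  finally have U: "distr M opt_space (\<lambda>\<omega>. \<psi> (X 0 \<omega>)) = opt_space"
    by simp
  have U_meas: "(\<lambda>\<omega>. \<psi> (X 0 \<omega>)) \<in> measurable M opt_space"
    using measurable_compose[OF X0 \<psi>] .
  have "distr M path_space ?P = distr M path_space (\<lambda>\<omega>. ?O (\<psi> (X 0 \<omega>)))"
  proof (rule distr_cong_AE)
    have "AE \<omega> in M. cdf (\<mu> 0) (X 0 \<omega>) \<in> {0<..<1} \<and>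
        (\<forall>t\<in>{0..1}. X t \<omega> = opt_process \<mu> t (cdf (\<mu> 0) (X 0 \<omega>)))"
      using eq by (rule AE_path_eq_quantile_path)
    then show "AE \<omega> in M. ?P \<omega> = ?O (\<psi> (X 0 \<omega>))"
    proof eventually_elim
      case (elim \<omega>)
      have "\<psi> (X 0 \<omega>) = cdf (\<mu> 0) (X 0 \<omega>)"
        using conjunct1[OF elim] unfolding \<psi>_def by (rule if_P)
      then show ?case
        using conjunct2[OF elim] by (intro restrict_ext) metis
    qed
  qed (auto intro: measurable_path_process measurable_compose[OF U_meas opt.measurable_path_process])
  also have "\<dots> = distr opt_space path_space ?O"
    using distr_distr[OF opt.measurable_path_process U_meas] U by (simp add: comp_def)
  finally show ?thesis
    by (simp add: path_law_def)
qed

end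

section \<open>Convex functions as mixtures of calls and puts\<close>

text \<open>The kernel of the integral form of Taylor's remainder at 0. It vanishes unless
  \<open>k\<close> lies between 0 and \<open>y\<close>, so for fixed \<open>y\<close> it has bounded
  support in the strike.\<close>

definition put_call :: "real \<Rightarrow> real \<Rightarrow> real" where
  "put_call k y = (if 0 < k then max 0 (y - k) else max 0 (k - y))"

lemma put_call_nonneg: "0 \<le> put_call k y"
  by (simp add: put_call_def)

lemma measurable_put_call [measurable (raw)]:
  assumes [measurable]: "f \<in> borel_measurable N" "g \<in> borel_measurable N"
  shows "(\<lambda>x. put_call (f x) (g x)) \<in> borel_measurable N"
  unfolding put_call_def by measurable

locale strictly_convex_C2 =
  fixes h D D2 :: "real \<Rightarrow> real"
  assumes strict: "strictly_convex h"
    and DERIV_h: "(h has_real_derivative D x) (at x)"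
    and DERIV_D: "(D has_real_derivative D2 x) (at x)"
    and continuous_D2: "continuous_on UNIV D2"
begin

lemma strict_ineq:
  "x \<noteq> y \<Longrightarrow> 0 < u \<Longrightarrow> u < 1 \<Longrightarrow> h (u * x + (1 - u) * y) < u * h x + (1 - u) * h y"
  using strict unfolding strictly_convex_def by blast

lemma convex_h: "convex_on UNIV h"
proof (rule convex_onI)
  fix t x y :: real assume "0 < t" "t < 1"
  then show "h ((1 - t) *\<^sub>R x + t *\<^sub>R y) \<le> (1 - t) * h x + t * h y"
    using strict_ineq[of y x t] by (cases "x = y") (auto simp: algebra_simps)
qed simp

lemma above_tangent: "D x * (y - x) \<le> h y - h x"
  using convex_h DERIV_h[of x] by (intro convex_on_imp_above_tangent[of UNIV]) auto

lemma D_mono: "x \<le> y \<Longrightarrow> D x \<le> D y"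
proof -
  assume "x \<le> y"
  have "0 \<le> (D y - D x) * (y - x)"
    using above_tangent[of x y] above_tangent[of y x] by (simp add: algebra_simps)
  then show "D x \<le> D y"
    using \<open>x \<le> y\<close> by (cases "x = y") (auto simp: zero_le_mult_iff)
qed

lemma D2_nonneg: "0 \<le> D2 x"
  using mono_on_imp_deriv_nonneg[of UNIV D "D2 x" x] DERIV_D by (auto simp: mono_on_def D_mono)

lemma continuous_h: "continuous_on UNIV h"
  using DERIV_h by (intro continuous_at_imp_continuous_on) (auto intro: DERIV_isCont)

lemma measurable_h [measurable]: "h \<in> borel_measurable borel"
  using continuous_h by (rule borel_measurable_continuous_onI)

lemma measurable_D2 [measurable]: "D2 \<in> borel_measurable borel"
  using continuous_D2 by (rule borel_measurable_continuous_onI)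

text \<open>Otherwise \<open>D\<close> is constant on an inner interval from \<open>u\<close> to
  \<open>v\<close>. The mean value theorem on its two halves then gives equal increments of
  \<open>h\<close>, so the midpoint value is the average of \<open>h u\<close> and
  \<open>h v\<close>, contrary to strict convexity.\<close>

lemma D2_positive_point:
  assumes "a < b"
  shows "\<exists>x\<in>{a<..<b}. 0 < D2 x"
proof (rule ccontr)
  assume no: "\<not> ?thesis"
  define u v where "u = a + (b - a) / 4" and "v = a + 3 * (b - a) / 4"
  have uv: "a < u" "u < v" "v < b"
    using assms by (auto simp: u_def v_def field_simps)
  have D: "D x = D u" if ux: "u \<le> x" "x \<le> v" for x
  proof (cases "u = x")
    case False
    then obtain z where "u < z" "z < x" "D x - D u = (x - u) * D2 z"
      using MVT2[of u x D D2] DERIV_D ux False by auto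
    moreover have "z \<in> {a<..<b}"
      using uv ux \<open>u < z\<close> \<open>z < x\<close> by simp
    then have "D2 z = 0"
      using no D2_nonneg[of z] by (meson antisym not_less)
    ultimately show ?thesis by simp
  qed simp
  define w where "w = (u + v) / 2"
  have w: "u < w" "w < v"
    using uv by (auto simp: w_def)
  obtain z where "u < z" "z < w" "h w - h u = (w - u) * D z"
    using MVT2[of u w h D] DERIV_h w by auto
  moreover obtain z' where "w < z'" "z' < v" "h v - h w = (v - w) * D z'"
    using MVT2[of w v h D] DERIV_h w by auto
  ultimately have "h w - h u = (w - u) * D u" "h v - h w = (v - w) * D u"
    using D[of z] D[of z'] w by auto
  moreover have "v - w = w - u"
    by (simp add: w_def field_simps)
  ultimately have "2 * h w = h u + h v"
    by simp
  then show False
    using strict_ineq[of u v "1 / 2"] uv by (simp add: w_def field_simps)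
qed

text \<open>The affine part contributes the same expectation for all processes, so only this
  remainder over the tangent at 0 has to be compared. Its nonnegativity permits integration before
  integrability is known.\<close>

definition "G x = h x - h 0 - D 0 * x"

lemma G_nonneg: "0 \<le> G x"
  using above_tangent[of 0 x] by (simp add: G_def)

lemma measurable_G [measurable]: "G \<in> borel_measurable borel"
  unfolding G_def[abs_def] by measurable

lemma G_scale:
  assumes "1 \<le> s"
  shows "s * G x \<le> G (s * x)"
proof -
  have "h ((1 - 1 / s) *\<^sub>R 0 + (1 / s) *\<^sub>R (s * x)) \<le> (1 - 1 / s) * h 0 + (1 / s) * h (s * x)"
    using assms by (intro convex_onD[OF convex_h]) auto
  then show ?thesis
    using assms by (simp add: G_def field_simps)
qed

lemma G_pos:
  assumes "x \<noteq> 0"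
  shows "0 < G x"
  using strict_ineq[of x 0 "1 / 2"] G_nonneg[of "x / 2"] assms by (simp add: G_def field_simps)

text \<open>Away from the interval between -1 and 1, convexity along the ray from 0 gives
  \<open>\<bar>x\<bar> * G (sgn x) \<le> G x\<close>; inside it the added constant suffices. This is
  how absolute values of \<open>x\<close> are controlled by \<open>h\<close>.\<close>

lemma G_grows_linearly: "\<exists>c>0. \<forall>x. c * \<bar>x\<bar> \<le> G x + c"
proof (intro exI conjI allI)
  let ?c = "min (G 1) (G (- 1))"
  show "0 < ?c"
    by (simp add: G_pos)
  fix x :: real
  show "?c * \<bar>x\<bar> \<le> G x + ?c"
  proof (cases "1 \<le> \<bar>x\<bar>")
    case True
    have "?c * \<bar>x\<bar> \<le> \<bar>x\<bar> * G (sgn x)"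
      using True by (auto simp: sgn_if mult.commute intro!: mult_left_mono)
    also have "\<dots> \<le> G x"
      using G_scale[OF True, of "sgn x"] by (simp add: abs_mult_sgn)
    finally show ?thesis
      using \<open>0 < ?c\<close> by linarith
  next
    case False
    then have "?c * \<bar>x\<bar> \<le> ?c * 1"
      using \<open>0 < ?c\<close> by (intro mult_left_mono) auto
    then show ?thesis
      using G_nonneg[of x] by linarith
  qed
qed

text \<open>Taylor's formula with integral remainder at 0: \<open>D k * (y - k) + h k\<close> is an
  antiderivative in \<open>k\<close> of \<open>D2 k * (y - k)\<close>.\<close>

lemma G_eq_put_call_mixture: "(\<integral>\<^sup>+k. ennreal (D2 k * put_call k y) \<partial>lborel) = ennreal (G y)"
proof -
  have deriv: "((\<lambda>k. D k * (y - k) + h k) has_real_derivative D2 x * (y - x)) (at x)" for x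
    by (auto intro!: derivative_eq_intros DERIV_D DERIV_h)
  have deriv': "((\<lambda>k. - (D k * (y - k) + h k)) has_real_derivative D2 x * (x - y)) (at x)" for x
    using DERIV_minus[OF deriv] by (rule DERIV_cong) (simp add: algebra_simps)
  \<comment> \<open>Strike 0 counts as a put, so for nonnegative \<open>y\<close> the kernel and the
    FTC integrand may differ at that one point.\<close>
  have ae: "AE k in lborel. k \<noteq> (0 :: real)"
    by (rule AE_lborel_singleton)
  show ?thesis
  proof (cases "0 \<le> y")
    case True
    have "(\<integral>\<^sup>+k. ennreal (D2 k * put_call k y) \<partial>lborel) =
        (\<integral>\<^sup>+k. ennreal (D2 k * (y - k)) * indicator {0..y} k \<partial>lborel)"
      using ae True by (intro nn_integral_cong_AE) (auto simp: put_call_def max_def split: split_indicator)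
    also have "\<dots> = ennreal ((D y * (y - y) + h y) - (D 0 * (y - 0) + h 0))"
      using True deriv D2_nonneg by (intro nn_integral_FTC_Icc) auto
    finally show ?thesis
      by (simp add: G_def algebra_simps)
  next
    case False
    have "(\<integral>\<^sup>+k. ennreal (D2 k * put_call k y) \<partial>lborel) =
        (\<integral>\<^sup>+k. ennreal (D2 k * (k - y)) * indicator {y..0} k \<partial>lborel)"
      using False by (intro nn_integral_cong) (auto simp: put_call_def max_def split: split_indicator)
    also have "\<dots> = ennreal ((- (D 0 * (y - 0) + h 0)) - (- (D y * (y - y) + h y)))"
      using False deriv' D2_nonneg by (intro nn_integral_FTC_Icc) auto
    finally show ?thesis
      by (simp add: G_def algebra_simps)
  qed
qed

end

section \<open>Comparison of payoffs\<close>

context integrable_process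
begin

text \<open>Used to pass from almost all strikes to all strikes.\<close>

lemma call_mean_Lipschitz:
  "\<bar>expectation (\<lambda>\<omega>. max 0 (average \<omega> - k)) - expectation (\<lambda>\<omega>. max 0 (average \<omega> - l))\<bar> \<le> \<bar>k - l\<bar>"
proof -
  have le: "expectation (\<lambda>\<omega>. max 0 (average \<omega> - k)) \<le> expectation (\<lambda>\<omega>. max 0 (average \<omega> - l)) + \<bar>k - l\<bar>" for k l
  proof -
    have "expectation (\<lambda>\<omega>. max 0 (average \<omega> - k)) \<le> expectation (\<lambda>\<omega>. max 0 (average \<omega> - l) + \<bar>k - l\<bar>)"
      using integrable_call by (intro integral_mono) auto
    then show ?thesis
      using integrable_call by (simp add: prob_space)
  qed
  show ?thesis
    using le[of k l] le[of l k] by (simp add: abs_le_iff abs_minus_commute)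
qed

end

locale put_call_process = strictly_convex_C2 + integrable_process
begin

lemma integrable_put_call: "integrable M (\<lambda>\<omega>. put_call k (average \<omega>))"
  unfolding put_call_def using integrable_average by (cases "0 < k") auto

text \<open>Put-call parity: the correction depends on the process only through its mean, hence is
  the same for the quantile process.\<close>

lemma expectation_put_call:
  "expectation (\<lambda>\<omega>. put_call k (average \<omega>)) =
    expectation (\<lambda>\<omega>. max 0 (average \<omega> - k)) + (if 0 < k then 0 else k - expectation average)"
proof -
  have "expectation (\<lambda>\<omega>. put_call k (average \<omega>)) =
      expectation (\<lambda>\<omega>. max 0 (average \<omega> - k) + (if 0 < k then 0 else k - average \<omega>))"
    by (intro Bochner_Integration.integral_cong) (auto simp: put_call_def)
  also have "\<dots> = expectation (\<lambda>\<omega>. max 0 (average \<omega> - k)) + expectation (\<lambda>\<omega>. if 0 < k then 0 else k - average \<omega>)"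
    using integrable_call integrable_average by (intro Bochner_Integration.integral_add) (cases "0 < k"; auto)+
  also have "expectation (\<lambda>\<omega>. if 0 < k then 0 else k - average \<omega>) = (if 0 < k then 0 else k - expectation average)"
    using integrable_average by (auto simp: prob_space)
  finally show ?thesis .
qed

lemma measurable_average [measurable]: "average \<in> borel_measurable M"
  using integrable_average by simp

lemma measurable_expectation_put_call:
  "(\<lambda>k. expectation (\<lambda>\<omega>. put_call k (average \<omega>))) \<in> borel_measurable borel"
  by measurable

lemma nn_expectation_G:
  "(\<integral>\<^sup>+\<omega>. ennreal (G (average \<omega>)) \<partial>M) = (\<integral>\<^sup>+k. ennreal (D2 k * expectation (\<lambda>\<omega>. put_call k (average \<omega>))) \<partial>lborel)"
proof -
  interpret lb: pair_sigma_finite lborel M ..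
  have "(\<integral>\<^sup>+\<omega>. ennreal (G (average \<omega>)) \<partial>M) = (\<integral>\<^sup>+\<omega>. \<integral>\<^sup>+k. ennreal (D2 k * put_call k (average \<omega>)) \<partial>lborel \<partial>M)"
    by (simp add: G_eq_put_call_mixture)
  also have "\<dots> = (\<integral>\<^sup>+k. \<integral>\<^sup>+\<omega>. ennreal (D2 k * put_call k (average \<omega>)) \<partial>M \<partial>lborel)"
    by (intro lb.Fubini') measurable
  also have "\<dots> = (\<integral>\<^sup>+k. ennreal (D2 k * expectation (\<lambda>\<omega>. put_call k (average \<omega>))) \<partial>lborel)"
    using integrable_put_call D2_nonneg put_call_nonneg
    by (intro nn_integral_cong) (subst nn_integral_eq_integral, auto)
  finally show ?thesis .
qed

end

context put_call_process
begin

lemma expectation_put_call_le_opt: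
  "expectation (\<lambda>\<omega>. put_call k (average \<omega>)) \<le> opt.expectation (\<lambda>p. put_call k (opt.average p))"
proof -
  interpret opt: put_call_process h D D2 \<mu> opt_space "opt_process \<mu>" ..
  show ?thesis
    using call_average_le_opt[of k] expectation_average_opt
    by (simp add: expectation_put_call opt.expectation_put_call)
qed

text \<open>The integrands over strikes are ordered and have the same finite integral, hence agree
  almost everywhere. A gap at \<open>k\<close> would persist on a neighbourhood, which contains a
  nonempty open set where \<open>D2\<close> is nonzero, and such a set is not null.\<close>

lemma call_mean_eq_opt:
  assumes finite: "(\<integral>\<^sup>+p. ennreal (G (opt.average p)) \<partial>opt_space) < \<infinity>"
    and eq: "(\<integral>\<^sup>+\<omega>. ennreal (G (average \<omega>)) \<partial>M) = (\<integral>\<^sup>+p. ennreal (G (opt.average p)) \<partial>opt_space)"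
  shows "expectation (\<lambda>\<omega>. max 0 (average \<omega> - k)) = opt.expectation (\<lambda>p. max 0 (opt.average p - k))"
proof (rule ccontr)
  interpret opt: put_call_process h D D2 \<mu> opt_space "opt_process \<mu>" ..
  define c where "c l = expectation (\<lambda>\<omega>. max 0 (average \<omega> - l))" for l
  define c' where "c' l = opt.expectation (\<lambda>p. max 0 (opt.average p - l))" for l
  define a where "a l = D2 l * expectation (\<lambda>\<omega>. put_call l (average \<omega>))" for l
  define a' where "a' l = D2 l * opt.expectation (\<lambda>p. put_call l (opt.average p))" for l
  have a_le: "a l \<le> a' l" and a_nonneg: "0 \<le> a l" for l
    unfolding a_def a'_def
    using D2_nonneg[of l] expectation_put_call_le_opt[of l] put_call_nonneg
    by (auto intro!: mult_left_mono mult_nonneg_nonneg integral_nonneg_AE)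
  then have a'_nonneg: "0 \<le> a' l" for l
    by (meson order_trans)
  have meas [measurable]: "a \<in> borel_measurable borel" "a' \<in> borel_measurable borel"
    unfolding a_def[abs_def] a'_def[abs_def]
    using measurable_expectation_put_call opt.measurable_expectation_put_call
    by (auto intro!: borel_measurable_times)
  have nn: "(\<integral>\<^sup>+l. ennreal (a l) \<partial>lborel) = (\<integral>\<^sup>+l. ennreal (a' l) \<partial>lborel)"
    "(\<integral>\<^sup>+l. ennreal (a' l) \<partial>lborel) < \<infinity>"
    using eq finite unfolding a_def a'_def nn_expectation_G opt.nn_expectation_G by simp_all
  have "AE l in lborel. a l = a' l"
  proof (rule integral_ineq_eq_0_then_AE)
    show "integrable lborel a" "integrable lborel a'"
      using nn a_nonneg a'_nonneg by (auto intro!: integrableI_nonneg)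
    show "integral\<^sup>L lborel a = integral\<^sup>L lborel a'"
      using nn(1) a_nonneg a'_nonneg by (simp add: integral_eq_nn_integral)
  qed (simp add: a_le)
  \<comment> \<open>The parity corrections coincide, so cancelling a nonzero \<open>D2 l\<close>
    leaves equality of the call prices.\<close>
  have a_eq: "a l = D2 l * (c l + (if 0 < l then 0 else l - expectation average))"
    "a' l = D2 l * (c' l + (if 0 < l then 0 else l - expectation average))" for l
    unfolding a_def a'_def c_def c'_def expectation_put_call opt.expectation_put_call expectation_average_opt
    by (rule refl)+
  have "D2 l \<noteq> 0 \<longrightarrow> c l = c' l" if "a l = a' l" for l
    using that unfolding a_eq by auto
  with \<open>AE l in lborel. a l = a' l\<close> have AE_eq: "AE l in lborel. D2 l \<noteq> 0 \<longrightarrow> c l = c' l"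
    by (rule eventually_mono)
  assume "expectation (\<lambda>\<omega>. max 0 (average \<omega> - k)) \<noteq> opt.expectation (\<lambda>p. max 0 (opt.average p - k))"
  then have "c k < c' k"
    using call_average_le_opt[of k] by (simp add: c_def c'_def)
  \<comment> \<open>Both prices move by at most \<open>\<bar>k - l\<bar>\<close>, so within half the
    gap they cannot meet.\<close>
  define r where "r = (c' k - c k) / 2"
  have r: "0 < r"
    using \<open>c k < c' k\<close> by (simp add: r_def)
  have less: "c l < c' l" if l: "\<bar>k - l\<bar> < r" for l
  proof -
    have "\<bar>c k - c l\<bar> \<le> \<bar>k - l\<bar>" "\<bar>c' k - c' l\<bar> \<le> \<bar>k - l\<bar>"
      unfolding c_def c'_def by (rule call_mean_Lipschitz opt.call_mean_Lipschitz)+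
    then have "c l \<le> c k + \<bar>k - l\<bar>" "c' k \<le> c' l + \<bar>k - l\<bar>"
      by linarith+
    moreover have "2 * \<bar>k - l\<bar> < c' k - c k"
      using l by (simp add: r_def)
    ultimately show ?thesis
      by argo
  qed
  define U where "U = {k - r<..<k + r} \<inter> {l. D2 l \<noteq> 0}"
  have "open U"
    unfolding U_def by (intro open_Int open_Collect_neq continuous_D2) auto
  moreover have "U \<noteq> {}"
    using D2_positive_point[of "k - r" "k + r"] r by (auto simp: U_def)
  moreover have "AE l in lborel. l \<notin> U"
    using AE_eq
  proof eventually_elim
    case (elim l)
    have "\<bar>k - l\<bar> < r \<and> D2 l \<noteq> 0" if "l \<in> U"
      using that by (auto simp: U_def abs_less_iff)
    then show ?case
      using elim less[of l] by auto
  qed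
  then have "U \<in> null_sets lborel"
    using \<open>open U\<close> by (subst AE_iff_null_sets) auto
  then have "negligible U"
    using null_sets_completionI negligible_iff_null_sets by blast
  ultimately show False
    using open_not_negligible by blast
qed

end

section \<open>Moment bounds and integrability of the payoff\<close>

locale payoff_setting = strictly_convex_C2 + quantile_path +
  assumes integrable_id: "t \<in> {0..1} \<Longrightarrow> integrable (\<mu> t) (\<lambda>x. x)"
    and integrable_h: "t \<in> {0..1} \<Longrightarrow> integrable (\<mu> t) h"
    and integrable_mean: "set_integrable lborel {0..1} (\<lambda>t. \<integral>x. x \<partial>\<mu> t)"
    and integrable_h_mean: "set_integrable lborel {0..1} (\<lambda>t. \<integral>x. h x \<partial>\<mu> t)"
begin

text \<open>Nonnegativity lets the inner integral be evaluated as the same combination of the means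
  of \<open>h\<close> and of \<open>x\<close>, whose integrability in time is assumed. Both
  \<open>G\<close> and a majorant of \<open>\<bar>x\<bar>\<close> have this form.\<close>

lemma finite_affine_moment:
  assumes "\<And>x. 0 \<le> \<alpha> * h x + \<beta> * x + \<gamma>"
  shows "(\<integral>\<^sup>+t. \<integral>\<^sup>+x. ennreal (\<alpha> * h x + \<beta> * x + \<gamma>) \<partial>\<mu> t \<partial>unit_time) < \<infinity>"
proof -
  have "(\<integral>\<^sup>+t. \<integral>\<^sup>+x. ennreal (\<alpha> * h x + \<beta> * x + \<gamma>) \<partial>\<mu> t \<partial>unit_time)
      = (\<integral>\<^sup>+t. ennreal (\<alpha> * (\<integral>x. h x \<partial>\<mu> t) + \<beta> * (\<integral>x. x \<partial>\<mu> t) + \<gamma>) \<partial>unit_time)"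
  proof (rule nn_integral_cong)
    fix t assume "t \<in> space unit_time"
    then have t: "t \<in> {0..1}" by (simp add: space_restrict_space)
    interpret interval_distribution "\<mu> t" using t by (rule interval_distribution)
    show "(\<integral>\<^sup>+x. ennreal (\<alpha> * h x + \<beta> * x + \<gamma>) \<partial>\<mu> t)
        = ennreal (\<alpha> * (\<integral>x. h x \<partial>\<mu> t) + \<beta> * (\<integral>x. x \<partial>\<mu> t) + \<gamma>)"
      using integrable_id[OF t] integrable_h[OF t] assms prob_space
      by (subst nn_integral_eq_integral) auto
  qed
  also have "\<dots> \<le> (\<integral>\<^sup>+t. ennreal (norm (\<alpha> * (\<integral>x. h x \<partial>\<mu> t) + \<beta> * (\<integral>x. x \<partial>\<mu> t) + \<gamma>)) \<partial>unit_time)"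
    by (intro nn_integral_mono ennreal_leI) auto
  also have "\<dots> < \<infinity>"
  proof -
    have "integrable unit_time (\<lambda>t. \<alpha> * (\<integral>x. h x \<partial>\<mu> t) + \<beta> * (\<integral>x. x \<partial>\<mu> t) + \<gamma>)"
      using integrable_mean integrable_h_mean
      by (intro Bochner_Integration.integrable_add integrable_mult_right)
         (auto simp: integrable_restrict_space set_integrable_def)
    then show ?thesis
      by (simp add: integrable_iff_bounded)
  qed
  finally show ?thesis .
qed

lemma finite_G_moment: "(\<integral>\<^sup>+t. \<integral>\<^sup>+x. ennreal (G x) \<partial>\<mu> t \<partial>unit_time) < \<infinity>"
proof -
  have "G = (\<lambda>x. 1 * h x + (- D 0) * x + (- h 0))"
    by (auto simp: G_def)
  then show ?thesis
    using finite_affine_moment[of 1 "- D 0" "- h 0"] G_nonneg by (simp add: G_def)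
qed

sublocale integrable_quantile_path
proof
  obtain c where c: "0 < c" "\<And>x. c * \<bar>x\<bar> \<le> G x + c"
    using G_grows_linearly by blast
  have le: "\<bar>x\<bar> \<le> (1 / c) * h x + (- D 0 / c) * x + (1 - h 0 / c)" for x
  proof -
    have "c * \<bar>x\<bar> \<le> c * ((1 / c) * h x + (- D 0 / c) * x + (1 - h 0 / c))"
      using c(1) c(2)[of x] by (simp add: G_def distrib_left right_diff_distrib)
    then show ?thesis
      using c(1) by (simp only: mult_le_cancel_left_pos)
  qed
  have "(\<integral>\<^sup>+t. \<integral>\<^sup>+x. ennreal \<bar>x\<bar> \<partial>\<mu> t \<partial>unit_time)
      \<le> (\<integral>\<^sup>+t. \<integral>\<^sup>+x. ennreal ((1 / c) * h x + (- D 0 / c) * x + (1 - h 0 / c)) \<partial>\<mu> t \<partial>unit_time)"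
    using le by (intro nn_integral_mono ennreal_leI) auto
  also have "\<dots> < \<infinity>"
    using le by (intro finite_affine_moment) (meson abs_ge_zero order_trans)
  finally show "(\<integral>\<^sup>+t. \<integral>\<^sup>+x. ennreal \<bar>x\<bar> \<partial>\<mu> t \<partial>unit_time) < \<infinity>" .
qed

end

locale payoff_process = payoff_setting + marginal_process
begin

sublocale put_call_process ..

lemma payoff_eq: "payoff h X \<omega> = G (average \<omega>) + (h 0 + D 0 * average \<omega>)"
  by (simp add: payoff_def set_integral_unit_time average_def G_def)

lemma G_average_le:
  assumes \<omega>: "\<omega> \<in> space M"
  shows "G (average \<omega>) \<le> (\<integral>t. G (X t \<omega>) \<partial>unit_time)"
proof -
  have int: "integrable unit_time (\<lambda>t. X t \<omega>)" "integrable unit_time (\<lambda>t. G (X t \<omega>))"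
    using continuous_path[OF \<omega>] unfolding G_def
    by (auto intro!: integrable_unit_time continuous_intros continuous_on_compose2[OF continuous_h])
  \<comment> \<open>The tangent of \<open>G\<close> at the time average; its linear term integrates
    to 0 along the path, which is Jensen's inequality.\<close>
  have "G (average \<omega>) + (D (average \<omega>) - D 0) * (x - average \<omega>) \<le> G x" for x
    using above_tangent[of "average \<omega>" x] by (simp add: G_def algebra_simps)
  then have "(\<integral>t. G (average \<omega>) + (D (average \<omega>) - D 0) * (X t \<omega> - average \<omega>) \<partial>unit_time)
      \<le> (\<integral>t. G (X t \<omega>) \<partial>unit_time)"
    using int by (intro integral_mono) auto
  moreover have "(\<integral>t. X t \<omega> - average \<omega> \<partial>unit_time) = 0"
    using int by (simp add: average_def measure_unit_time)
  ultimately show ?thesis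
    using int by (simp add: measure_unit_time)
qed

text \<open>Jensen bounds the average by a time integral that depends on the marginals only. This
  makes every payoff integrable and \<open>enn2real\<close> lossless.\<close>

lemma nn_expectation_G_finite: "(\<integral>\<^sup>+\<omega>. ennreal (G (average \<omega>)) \<partial>M) < \<infinity>"
proof -
  have "(\<integral>\<^sup>+\<omega>. ennreal (G (average \<omega>)) \<partial>M) \<le> (\<integral>\<^sup>+\<omega>. \<integral>\<^sup>+t. ennreal (G (X t \<omega>)) \<partial>unit_time \<partial>M)"
  proof (rule nn_integral_mono)
    fix \<omega> assume \<omega>: "\<omega> \<in> space M"
    have "integrable unit_time (\<lambda>t. G (X t \<omega>))"
      using continuous_path[OF \<omega>] unfolding G_def
      by (auto intro!: integrable_unit_time continuous_intros continuous_on_compose2[OF continuous_h])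
    then show "ennreal (G (average \<omega>)) \<le> (\<integral>\<^sup>+t. ennreal (G (X t \<omega>)) \<partial>unit_time)"
      using G_average_le[OF \<omega>] G_nonneg by (subst nn_integral_eq_integral) (auto intro: ennreal_leI)
  qed
  also have "\<dots> = (\<integral>\<^sup>+t. \<integral>\<^sup>+x. ennreal (G x) \<partial>\<mu> t \<partial>unit_time)"
    by (intro nn_integral_process) measurable
  also have "\<dots> < \<infinity>"
    by (rule finite_G_moment)
  finally show ?thesis .
qed

lemma integrable_G_average: "integrable M (\<lambda>\<omega>. G (average \<omega>))"
  using nn_expectation_G_finite G_nonneg measurable_average by (intro integrableI_nonneg) auto

lemma integrable_payoff: "integrable M (payoff h X)"
  unfolding payoff_eq[abs_def] using integrable_G_average integrable_average by simp

lemma expectation_payoff: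
  "expectation (payoff h X) =
    enn2real (\<integral>\<^sup>+\<omega>. ennreal (G (average \<omega>)) \<partial>M) + (h 0 + D 0 * (\<integral>t. \<integral>x. x \<partial>\<mu> t \<partial>unit_time))"
proof -
  have "expectation (payoff h X) = expectation (\<lambda>\<omega>. G (average \<omega>)) + (h 0 + D 0 * expectation average)"
    unfolding payoff_eq[abs_def] using integrable_G_average integrable_average by (simp add: prob_space)
  then show ?thesis
    using integrable_G_average G_nonneg by (simp add: expectation_average integral_eq_nn_integral)
qed

end

sublocale payoff_setting \<subseteq> opt: payoff_process h D D2 \<mu> opt_space "opt_process \<mu>"
  by unfold_locales (rule opt_process_in)

section \<open>Optimality and uniqueness\<close>

context payoff_process
begin

lemma nn_expectation_G_le_opt:
  "(\<integral>\<^sup>+\<omega>. ennreal (G (average \<omega>)) \<partial>M) \<le> (\<integral>\<^sup>+p. ennreal (G (opt.average p)) \<partial>opt_space)"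
  unfolding nn_expectation_G opt.nn_expectation_G
  using D2_nonneg expectation_put_call_le_opt by (intro nn_integral_mono ennreal_leI mult_left_mono)

theorem expectation_payoff_le_opt: "expectation (payoff h X) \<le> opt.expectation (payoff h (opt_process \<mu>))"
  unfolding expectation_payoff opt.expectation_payoff
  using enn2real_mono[OF nn_expectation_G_le_opt] opt.nn_expectation_G_finite by simp

theorem path_law_unique:
  assumes "expectation (payoff h X) = opt.expectation (payoff h (opt_process \<mu>))"
  shows "path_law M X = path_law opt_space (opt_process \<mu>)"
proof (rule path_law_eq_of_call_eq, rule call_mean_eq_opt)
  show "(\<integral>\<^sup>+p. ennreal (G (opt.average p)) \<partial>opt_space) < \<infinity>"
    by (rule opt.nn_expectation_G_finite)
  have "enn2real (\<integral>\<^sup>+\<omega>. ennreal (G (average \<omega>)) \<partial>M) = enn2real (\<integral>\<^sup>+p. ennreal (G (opt.average p)) \<partial>opt_space)"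
    using assms by (simp add: expectation_payoff opt.expectation_payoff)
  then show "(\<integral>\<^sup>+\<omega>. ennreal (G (average \<omega>)) \<partial>M) = (\<integral>\<^sup>+p. ennreal (G (opt.average p)) \<partial>opt_space)"
    using nn_expectation_G_finite opt.nn_expectation_G_finite
    by (metis ennreal_enn2real_if infinity_ennreal_def less_irrefl)
qed

end

theorem theorem3p1p1:
  fixes h :: "real \<Rightarrow> real" and \<mu> :: "real \<Rightarrow> real measure"
  assumes "\<forall>t\<in>{0..1}. prob_space (\<mu> t) \<and> sets (\<mu> t) = sets borel"
    and "strictly_convex h" and "C2_function h"
    and "\<forall>t\<in>{0..1}. absolutely_continuous lborel (\<mu> t)"
    and "\<forall>t\<in>{0..1}. \<exists>a b :: ereal. measure_support (\<mu> t) = {x. a \<le> ereal x \<and> ereal x \<le> b}"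
    and "weakly_continuous_path \<mu>"
    and "\<forall>t\<in>{0..1}. integrable (\<mu> t) (\<lambda>x. x)"
    and "\<forall>t\<in>{0..1}. integrable (\<mu> t) h"
    and "set_integrable lborel {0..1} (\<lambda>t. \<integral>x. x \<partial>\<mu> t)"
    and "set_integrable lborel {0..1} (\<lambda>t. \<integral>x. h x \<partial>\<mu> t)"
    and "\<forall>K. compact K \<and> K \<subseteq> {0<..<1} \<longrightarrow>
           uniform_limit K
             (\<lambda>N q. (1 / real N) * (\<Sum>i=1..N. cdf_inverse (\<mu> (real i / real N)) q))
             (\<lambda>q. LINT t:{0..1}|lborel. cdf_inverse (\<mu> t) q) sequentially"
  shows "(opt_space, opt_process \<mu>) \<in> processes_with_marginals \<mu> \<and>
         integrable opt_space (payoff h (opt_process \<mu>)) \<and>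
         (\<forall>(M :: 'w measure) X. (M, X) \<in> processes_with_marginals \<mu> \<longrightarrow>
            integrable M (payoff h X) \<and>
            (\<integral>\<omega>. payoff h X \<omega> \<partial>M) \<le> (\<integral>q. payoff h (opt_process \<mu>) q \<partial>opt_space) \<and>
            ((\<integral>\<omega>. payoff h X \<omega> \<partial>M) = (\<integral>q. payoff h (opt_process \<mu>) q \<partial>opt_space) \<longrightarrow>
               path_law M X = path_law opt_space (opt_process \<mu>)))"
proof -
  obtain D where D: "\<And>x. (h has_real_derivative D x) (at x)" "D C1_differentiable_on UNIV"
    using assms(3) unfolding C2_function_def by blast
  obtain D2 where D2: "\<And>x. (D has_real_derivative D2 x) (at x)" "continuous_on UNIV D2"
    using D(2) unfolding C1_differentiable_on_def has_real_derivative_iff_has_vector_derivative by blast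
  interpret payoff_setting h D D2 \<mu>
  proof (intro payoff_setting.intro strictly_convex_C2.intro quantile_path.intro payoff_setting_axioms.intro)
    fix t :: real assume "t \<in> {0..1}"
    then show "interval_distribution (\<mu> t)"
      using assms(1,4,5)
      by (auto simp: interval_distribution_def interval_distribution_axioms_def
          real_distribution_def real_distribution_axioms_def)
    show "integrable (\<mu> t) (\<lambda>x. x)" "integrable (\<mu> t) h"
      using assms(7,8) \<open>t \<in> {0..1}\<close> by blast+
  next
    fix x
    show "(h has_real_derivative D x) (at x)" "(D has_real_derivative D2 x) (at x)"
      by (rule D D2)+
  qed (rule assms D2)+
  have "integrable M (payoff h X) \<and>
      (\<integral>\<omega>. payoff h X \<omega> \<partial>M) \<le> (\<integral>q. payoff h (opt_process \<mu>) q \<partial>opt_space) \<and>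
      ((\<integral>\<omega>. payoff h X \<omega> \<partial>M) = (\<integral>q. payoff h (opt_process \<mu>) q \<partial>opt_space) \<longrightarrow>
         path_law M X = path_law opt_space (opt_process \<mu>))"
    if "(M, X) \<in> processes_with_marginals \<mu>" for M :: "'w measure" and X
  proof -
    interpret payoff_process h D D2 \<mu> M X
      using that by unfold_locales
    show ?thesis
      using integrable_payoff expectation_payoff_le_opt path_law_unique by blast
  qed
  then show ?thesis
    using opt_process_in opt.integrable_payoff by blast
qed

end
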